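(* Let $f:\mathbb{R}^d\to\mathbb{R}$ be convex and $L$-smooth with $f_*=\min f$. Suppose $f(x_0)-f_*\le\xi_0$, that $f$ satisfies the HEB condition on $\mathcal{S}_{\xi_0}$ with parameters $\theta\in(0,1/2]$ and $c>0$, and that $0<c_0\le c$. Let $\epsilon_0=\|\nabla f(x_0)\|_2$, $0<\epsilon\le\epsilon_0$, $K=\lceil\log_2(\epsilon_0/\epsilon)\rceil$ and $p=(1-2\theta)/(1-\theta)$. Then the iteration complexity of adaAGC (smooth version, run with inputs $x_0,c_0,\gamma>1$ and $K$ stages) for having $\|\nabla f(x_K)\|_2\le\epsilon$ is $$\widetilde O\!\left(\sqrt{L}\,c^{\frac{1}{2(1-\theta)}}\max\left(\frac{1}{\epsilon^{p/2}},\ \log(\epsilon_0/\epsilon)\right)\right),$$ where $\widetilde O(\cdot)$ suppresses a log term depending on $c,c_0,L,\gamma$.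
   Context: $f$ is $L$-smooth ($L>0$) if it is differentiable with $\|\nabla f(x)-\nabla f(y)\|_2\le L\|x-y\|_2$ for all $x,y$. $\Omega_*$ is the (nonempty) set of minimizers of $f$, $D(x,\Omega_* )=\min_{y\in\Omega_*}\|x-y\|_2$, $\mathcal{S}_\xi=\{x: f(x)-f_*\le\xi\}$. HEB condition on $\mathcal{S}_\xi$ with parameters $\theta,c$: $D(x,\Omega_* )\le c\,(f(x)-f_* )^\theta$ for all $x\in\mathcal{S}_\xi$. adaAGC (smooth version), which is given $L$ and $\theta$: set $c_e=c_0$ and $\epsilon_0=\|\nabla f(x_0)\|_2$. For stages $k=1,\dots,K$, perform cycles $s=1,2,\dots$ as follows. In each cycle let $$\delta_k=\frac{\epsilon_{k-1}^{\frac{1-2\theta}{1-\theta}}}{6\,c_e^{1/(1-\theta)}},\qquad f_{\delta_k}(x)=f(x)+\frac{\delta_k}{2}\|x-x_{k-1}\|_2^2,$$ set $x^k_1=y_1=x_{k-1}$, and for $\tau=1,2,\dots$ compute $$x^k_{\tau+1}=y_\tau-\frac{1}{L+\delta_k}\nabla f_{\delta_k}(y_\tau),\qquad y_{\tau+1}=x^k_{\tau+1}+\frac{\sqrt{L+\delta_k}-\sqrt{\delta_k}}{\sqrt{L+\delta_k}+\sqrt{\delta_k}}\,(x^k_{\tau+1}-x^k_\tau).$$ If $\|\nabla f(x^k_{\tau+1})\|_2\le\epsilon_{k-1}/2$, set $x_k=x^k_{\tau+1}$, $\epsilon_k=\epsilon_{k-1}/2$ and go to stage $k+1$. Otherwise,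 if $\tau=\left\lceil2\sqrt{\frac{L+\delta_k}{\delta_k}}\log\frac{\sqrt{L(L+\delta_k)}}{\delta_k}\right\rceil$, replace $c_e$ by $\gamma c_e$ and start the next cycle of the same stage. The output is $x_K$. The iteration complexity is the total number of inner iterations over all cycles and stages.
   Formalization: A cycle ends when τ is at least (not exactly equal to) the prescribed length, since for nonpositive length the literal method may never stop; for θ<1/2 the suppressed log term also contains log(1/ε), without which the bound fails. *)

theory Defs
  imports "HOL-Analysis.Analysis"
begin

definition grad :: "('a::euclidean_space \<Rightarrow> real) \<Rightarrow> 'a \<Rightarrow> 'a" where
  "grad f x = (THE D. GDERIV f x :> D)"

definition smooth_fun :: "real \<Rightarrow> ('a::euclidean_space \<Rightarrow> real) \<Rightarrow> bool" where
  "smooth_fun L f \<longleftrightarrow>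
     (\<forall>x. f differentiable (at x)) \<and>
     (\<forall>x y. norm (grad f x - grad f y) \<le> L * norm (x - y))"

definition minimizers :: "('a \<Rightarrow> real) \<Rightarrow> 'a set" where
  "minimizers f = {x. \<forall>y. f x \<le> f y}"

(* Equals the minimum of f as soon as minimizers f is nonempty. *)
definition min_value :: "('a \<Rightarrow> real) \<Rightarrow> real" where
  "min_value f = (INF x. f x)"

definition sublevel :: "('a \<Rightarrow> real) \<Rightarrow> real \<Rightarrow> 'a set" where
  "sublevel f \<xi> = {x. f x - min_value f \<le> \<xi>}"

(* For continuous f with a minimizer, the set of minimizers is closed and nonempty, so the
   infimum in infdist is attained. *)
definition HEB_on :: "'a set \<Rightarrow> ('a::euclidean_space \<Rightarrow> real) \<Rightarrow> real \<Rightarrow> real \<Rightarrow> bool" where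
  "HEB_on S f \<theta> c \<longleftrightarrow>
     (\<forall>x\<in>S. infdist x (minimizers f) \<le> c * (f x - min_value f) powr \<theta>)"

definition reg_fun :: "('a::euclidean_space \<Rightarrow> real) \<Rightarrow> real \<Rightarrow> 'a \<Rightarrow> 'a \<Rightarrow> real" where
  "reg_fun f \<delta> z x = f x + \<delta> / 2 * (norm (x - z))\<^sup>2"

definition adaAGC_delta :: "real \<Rightarrow> real \<Rightarrow> real \<Rightarrow> real" where
  "adaAGC_delta \<theta> e ce = e powr ((1 - 2 * \<theta>) / (1 - \<theta>)) / (6 * ce powr (1 / (1 - \<theta>)))"

definition adaAGC_cycle_length :: "real \<Rightarrow> real \<Rightarrow> int" where
  "adaAGC_cycle_length L \<delta> = \<lceil>2 * sqrt ((L + \<delta>) / \<delta>) * ln (sqrt (L * (L + \<delta>)) / \<delta>)\<rceil>"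

(* State before an inner iteration of stage k = stages_done + 1: center is x_(k-1),
   eps is epsilon_(k-1), cest is the current estimate c_e, tau is the number of the inner
   iteration about to be performed, xcur and ycur are x^k_tau and y_tau. *)
record 'a adaAGC_state =
  stages_done :: nat
  center :: 'a
  eps :: real
  cest :: real
  tau :: nat
  xcur :: 'a
  ycur :: 'a

definition adaAGC_init ::
  "('a::euclidean_space \<Rightarrow> real) \<Rightarrow> 'a \<Rightarrow> real \<Rightarrow> 'a adaAGC_state" where
  "adaAGC_init f x0 c0 =
     \<lparr>stages_done = 0, center = x0, eps = norm (grad f x0), cest = c0,
      tau = 1, xcur = x0, ycur = x0\<rparr>"

(* One inner iteration, together with the bookkeeping after it. tau runs through 1, 2, ..., so
   testing with \<ge> instead of = matters only if the cycle length is nonpositive, which happens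
   for delta large compared to L; the cycle is then abandoned after its first iteration. With =
   such a cycle would have no iteration cap at all and may run forever. *)
definition adaAGC_step ::
  "('a::euclidean_space \<Rightarrow> real) \<Rightarrow> real \<Rightarrow> real \<Rightarrow> real \<Rightarrow> 'a adaAGC_state \<Rightarrow> 'a adaAGC_state" where
  "adaAGC_step f L \<theta> \<gamma> s =
    (let \<delta> = adaAGC_delta \<theta> (eps s) (cest s);
         x' = ycur s - (1 / (L + \<delta>)) *\<^sub>R grad (reg_fun f \<delta> (center s)) (ycur s);
         y' = x' + ((sqrt (L + \<delta>) - sqrt \<delta>) / (sqrt (L + \<delta>) + sqrt \<delta>)) *\<^sub>R (x' - xcur s)
     in if norm (grad f x') \<le> eps s / 2
        then \<lparr>stages_done = stages_done s + 1, center = x', eps = eps s / 2, cest = cest s,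
              tau = 1, xcur = x', ycur = x'\<rparr>
        else if int (tau s) \<ge> adaAGC_cycle_length L \<delta>
        then s\<lparr>cest := \<gamma> * cest s, tau := 1, xcur := center s, ycur := center s\<rparr>
        else s\<lparr>tau := tau s + 1, xcur := x', ycur := y'\<rparr>)"

(* State after n inner iterations in total. *)
definition adaAGC ::
  "('a::euclidean_space \<Rightarrow> real) \<Rightarrow> real \<Rightarrow> real \<Rightarrow> real \<Rightarrow> 'a \<Rightarrow> real \<Rightarrow> nat \<Rightarrow> 'a adaAGC_state" where
  "adaAGC f L \<theta> \<gamma> x0 c0 n = (adaAGC_step f L \<theta> \<gamma> ^^ n) (adaAGC_init f x0 c0)"

(* The run with K stages halts, with output x, after exactly N inner iterations. *)
definition adaAGC_halts ::
  "('a::euclidean_space \<Rightarrow> real) \<Rightarrow> real \<Rightarrow> real \<Rightarrow> real \<Rightarrow> 'a \<Rightarrow> real \<Rightarrow> nat \<Rightarrow> nat \<Rightarrow> 'a \<Rightarrow> bool" where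
  "adaAGC_halts f L \<theta> \<gamma> x0 c0 K N x \<longleftrightarrow>
     stages_done (adaAGC f L \<theta> \<gamma> x0 c0 N) = K \<and>
     (\<forall>n<N. stages_done (adaAGC f L \<theta> \<gamma> x0 c0 n) < K) \<and>
     center (adaAGC f L \<theta> \<gamma> x0 c0 N) = x"

(* The constant hidden in the O-notation. It is written out, rather than quantified
   existentially, so that it visibly depends on theta and gamma only and not on the dimension,
   which is a type. The factor 1 / (1 - 2 powr (-p/2)) is the limit of the geometric series
   arising when epsilon is halved in every stage (p > 0). *)
definition hidden_const :: "real \<Rightarrow> real \<Rightarrow> real" where
  "hidden_const \<theta> \<gamma> =
     100 * \<gamma> powr (1 / (2 * (1 - \<theta>))) *
     (if \<theta> = 1 / 2 then 1 else 1 / (1 - 2 powr (- ((1 - 2 * \<theta>) / (1 - \<theta>)) / 2)))"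

(* The logarithms suppressed by the soft O: the first factor accounts for the cycles in which
   c_e is enlarged, the second one for the logarithm in the cycle length, whose delta contains
   c_e, which stays below gamma * c. The latter brings in epsilon unless theta = 1/2. *)
definition suppressed_log :: "real \<Rightarrow> real \<Rightarrow> real \<Rightarrow> real \<Rightarrow> real \<Rightarrow> real \<Rightarrow> real" where
  "suppressed_log \<theta> c c0 L \<gamma> \<epsilon> =
     (1 + log \<gamma> (c / c0)) *
     (1 + ln (L * (\<gamma> * c) powr (1 / (1 - \<theta>)) / \<epsilon> powr ((1 - 2 * \<theta>) / (1 - \<theta>))))"

end

theory Submission
  imports Defs
begin

text \<open>
Every cycle minimizes the \<open>\<delta>\<close>-strongly convex function \<open>f_\<delta> = f + \<delta>/2 |x - z|^2\<close>, where \<open>z\<close> is the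
centre of the stage, by an accelerated gradient method with constant momentum. Three facts about
such a cycle carry the proof.

\<^item> The iterates never leave the sublevel set of \<open>z\<close> (\<open>cycle_iterate_descends\<close>). Accelerated methods are
  not monotone, but with a momentum coefficient at most 1 the energy
  \<open>f_\<delta>(x_n) + M/2 |x_n - x_(n-1)|^2\<close> decreases, where \<open>M = L + \<delta>\<close>, and at the first iterate it
  equals \<open>f(z)\<close>. By induction all centres satisfy \<open>f(z) \<le> f(x_0)\<close>, so the error bound, which is only
  assumed on a sublevel set, can be used throughout the run.

\<^item> A cycle of full length ends at a point where the gradient of \<open>f\<close> is at most \<open>3 \<delta> D(z)\<close>, \<open>D\<close> being
  the distance to the minimizers (\<open>cycle_grad_le\<close>, for \<open>\<delta> \<le> L/6\<close>). Indeed Nesterov's potential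
  contracts by the factor \<open>1 - sqrt(\<delta>/M)\<close>, the cycle length makes the remaining gap of \<open>f_\<delta>\<close>
  negligible, and the minimizer of \<open>f_\<delta>\<close> is at distance at most \<open>D(z)\<close> from \<open>z\<close>.

\<^item> Convexity turns the error bound into \<open>D(z) \<le> c^(1/(1-\<theta>)) |grad f(z)|^(\<theta>/(1-\<theta>))\<close>
  (\<open>HEB_infdist_le\<close>). If \<open>e \<ge> |grad f(z)|\<close> is the tolerance of the stage, the choice of \<open>\<delta>\<close> is
  such that \<open>3 \<delta> D(z) \<le> e/2\<close> as soon as the estimate \<open>c_e\<close> is at least \<open>c\<close>; then also \<open>\<delta> \<le> L/6\<close>, by
  the lower bound for \<open>L c^(1/(1-\<theta>))\<close> that follows from smoothness (\<open>HEB_grad_powr_le\<close>). Hence a cycle can fail only while \<open>c_e < c\<close> (\<open>cycle_succeeds\<close>).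

So \<open>c_e\<close> never exceeds \<open>\<gamma> c\<close>, there are at most \<open>1 + log \<gamma> (c / c_0)\<close> failures in the whole run, and
all other cycles complete a stage (\<open>adaAGC_halts_within\<close>). A cycle of a stage with tolerance \<open>e\<close> costs
\<open>O(sqrt (L (\<gamma> c)^(1/(1-\<theta>)) / e^p))\<close> iterations up to a logarithm (\<open>cycle_cap_le\<close>). As the tolerances
are halved, these costs form a geometric sequence dominated by the last stage if \<open>p > 0\<close>, and they are
constant over about \<open>log 2 (\<epsilon>_0 / \<epsilon>)\<close> stages if \<open>p = 0\<close> (\<open>stage_cost_sum_le\<close>).
\<close>

section \<open>Gradients of smooth convex functions\<close>

lemma grad_eqI:
  assumes "GDERIV f x :> D"
  shows "grad f x = D"
  unfolding grad_def
proof (rule the_equality[where P = "\<lambda>D. GDERIV f x :> D", OF assms])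
  fix D' assume "GDERIV f x :> D'"
  then have "(\<lambda>h. h \<bullet> D') = (\<lambda>h. h \<bullet> D)"
    using assms unfolding gderiv_def by (rule has_derivative_unique)
  then show "D' = D"
    by (metis (full_types) inner_commute vector_eq_ldot)
qed

lemma GDERIV_grad:
  fixes f :: "'a::euclidean_space \<Rightarrow> real"
  assumes "f differentiable (at x)"
  shows "GDERIV f x :> grad f x"
proof -
  obtain f' where f': "(f has_derivative f') (at x)"
    using assms unfolding differentiable_def by blast
  then have lin: "linear f'"
    by (rule has_derivative_linear)
  define D where "D = (\<Sum>b\<in>Basis. f' b *\<^sub>R b)"
  have "f' h = h \<bullet> D" for h
  proof -
    have "f' h = f' (\<Sum>b\<in>Basis. (h \<bullet> b) *\<^sub>R b)"
      by (simp add: euclidean_representation)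
    also have "\<dots> = (\<Sum>b\<in>Basis. (h \<bullet> b) * f' b)"
      by (simp add: linear_sum[OF lin] linear_cmul[OF lin])
    also have "\<dots> = h \<bullet> D"
      by (simp add: D_def inner_sum_right mult.commute)
    finally show ?thesis .
  qed
  then have "GDERIV f x :> D"
    using f' unfolding gderiv_def by (metis (no_types, lifting) ext)
  then show ?thesis
    using grad_eqI by metis
qed

lemma DERIV_along_line:
  fixes f :: "'a::euclidean_space \<Rightarrow> real"
  assumes "\<And>x. f differentiable (at x)"
  shows "((\<lambda>t. f (x + t *\<^sub>R h)) has_real_derivative (grad f (x + t *\<^sub>R h) \<bullet> h)) (at t within S)"
proof -
  have "(f has_derivative (\<lambda>k. k \<bullet> grad f (x + t *\<^sub>R h))) (at (x + t *\<^sub>R h))"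
    using GDERIV_grad[OF assms] unfolding gderiv_def .
  moreover have "((\<lambda>t. x + t *\<^sub>R h) has_derivative (\<lambda>s. s *\<^sub>R h)) (at t within S)"
    by (auto intro!: derivative_eq_intros)
  ultimately have "((\<lambda>t. f (x + t *\<^sub>R h)) has_derivative (\<lambda>s. (s *\<^sub>R h) \<bullet> grad f (x + t *\<^sub>R h))) (at t within S)"
    by (rule has_derivative_compose[rotated])
  moreover have "(\<lambda>s. (s *\<^sub>R h) \<bullet> grad f (x + t *\<^sub>R h)) = (*) (grad f (x + t *\<^sub>R h) \<bullet> h)"
    by (auto simp: inner_commute)
  ultimately show ?thesis
    unfolding has_field_derivative_def by simp
qed

text \<open>
Restriction to the line through the two points reduces the claim to one real variable.
\<close>

lemma convex_above_tangent:
  fixes f :: "'a::euclidean_space \<Rightarrow> real"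
  assumes "convex_on UNIV f" and "\<And>x. f differentiable (at x)"
  shows "f x + grad f x \<bullet> (y - x) \<le> f y"
proof -
  define g where "g t = f (x + t *\<^sub>R (y - x))" for t
  have "convex_on UNIV g"
  proof (rule convex_onI)
    fix t a b :: real assume "0 < t" "t < 1"
    have "x + ((1 - t) * a + t * b) *\<^sub>R (y - x)
        = (1 - t) *\<^sub>R (x + a *\<^sub>R (y - x)) + t *\<^sub>R (x + b *\<^sub>R (y - x))"
      by (simp add: algebra_simps)
    then show "g ((1 - t) *\<^sub>R a + t *\<^sub>R b) \<le> (1 - t) * g a + t * g b"
      unfolding g_def using convex_onD[OF assms(1), of t] \<open>0 < t\<close> \<open>t < 1\<close> by simp
  qed simp
  moreover have "(g has_real_derivative grad f x \<bullet> (y - x)) (at 0)"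
    unfolding g_def using DERIV_along_line[OF assms(2), of x "y - x" 0] by simp
  ultimately have "g 1 - g 0 \<ge> (grad f x \<bullet> (y - x)) * (1 - 0)"
    by (intro convex_on_imp_above_tangent) auto
  then show ?thesis
    by (simp add: g_def)
qed

text \<open>
Along the segment, the Lipschitz bound on the gradient says that the function minus its claimed
quadratic upper bound has nonpositive derivative.
\<close>

lemma smooth_below_quadratic:
  fixes f :: "'a::euclidean_space \<Rightarrow> real"
  assumes "smooth_fun L f"
  shows "f y \<le> f x + grad f x \<bullet> (y - x) + L / 2 * (norm (y - x))\<^sup>2"
proof -
  define h where "h = y - x"
  define g where "g t = f (x + t *\<^sub>R h) - t * (grad f x \<bullet> h) - L / 2 * t\<^sup>2 * (norm h)\<^sup>2" for t
  have diff: "f differentiable (at x)" for x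
    using assms unfolding smooth_fun_def by auto
  have lip: "norm (grad f x - grad f y) \<le> L * norm (x - y)" for x y
    using assms unfolding smooth_fun_def by auto
  have "g 0 \<ge> g 1"
  proof (rule DERIV_nonpos_imp_nonincreasing[where f = g])
    fix t :: real assume t: "0 \<le> t" "t \<le> 1"
    let ?g' = "grad f (x + t *\<^sub>R h) \<bullet> h - grad f x \<bullet> h - L * t * (norm h)\<^sup>2"
    have "DERIV g t :> ?g'"
      unfolding g_def by (auto intro!: derivative_eq_intros DERIV_along_line diff)
    moreover have "(grad f (x + t *\<^sub>R h) - grad f x) \<bullet> h \<le> L * t * norm h * norm h"
    proof -
      have "(grad f (x + t *\<^sub>R h) - grad f x) \<bullet> h \<le> norm (grad f (x + t *\<^sub>R h) - grad f x) * norm h"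
        by (rule norm_cauchy_schwarz)
      also have "\<dots> \<le> (L * norm (t *\<^sub>R h)) * norm h"
        using lip[of "x + t *\<^sub>R h" x] by (intro mult_right_mono) auto
      finally show ?thesis
        using t by simp
    qed
    ultimately show "\<exists>y. DERIV g t :> y \<and> y \<le> 0"
      by (intro exI[of _ ?g']) (auto simp: inner_diff_left power2_eq_square)
  qed simp
  then show ?thesis
    by (simp add: g_def h_def)
qed

section \<open>Accelerated gradient iteration with constant momentum\<close>

text \<open>
The pair consists of the gradient-step iterate and the extrapolated point at which the next gradient is
taken.
\<close>

primrec agc :: "('a::real_vector \<Rightarrow> 'a) \<Rightarrow> real \<Rightarrow> real \<Rightarrow> 'a \<Rightarrow> nat \<Rightarrow> 'a \<times> 'a" where
  "agc G M \<beta> z 0 = (z, z)"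
| "agc G M \<beta> z (Suc n) =
    (let x' = snd (agc G M \<beta> z n) - (1 / M) *\<^sub>R G (snd (agc G M \<beta> z n))
     in (x', x' + \<beta> *\<^sub>R (x' - fst (agc G M \<beta> z n))))"

text \<open>
The algebra behind the contraction of Nesterov's potential: the left-hand side, which has to be
nonnegative, is a weighted sum of the slacks of the strong convexity inequalities at the current iterate and at
the comparison point and of the slack of the descent inequality, plus a nonnegative multiple of \<open>dd\<close>. The letters
stand for function values and inner products.
\<close>

lemma potential_identity:
  fixes q hd :: real
  shows "(1 - q) * (Fx - Fu + m * (bb + dd + 2 * bd))
      - (Fx' - Fu + m * (bb + (1 - q)\<^sup>2 * dd + hh + 2 * (1 - q) * bd - 2 * hb - 2 * (1 - q) * hd))
    = ((1 - q) * Fx - (1 - q) * (Fy - 2 * m * hd + m * q\<^sup>2 * dd))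
      + (q * Fu - (q * Fy - 2 * m * hb + q * m * bb))
      + (Fy - m * hh - Fx') + m * ((1 - q) * (q + q\<^sup>2) * dd)"
  by algebra

locale strongly_convex_smooth =
  fixes F :: "'a::euclidean_space \<Rightarrow> real" and G :: "'a \<Rightarrow> 'a" and \<mu> M :: real
  assumes mu_pos: "0 < \<mu>" and mu_less: "\<mu> < M"
    and above: "F x + G x \<bullet> (y - x) + \<mu> / 2 * (norm (y - x))\<^sup>2 \<le> F y"
    and below: "F y \<le> F x + G x \<bullet> (y - x) + M / 2 * (norm (y - x))\<^sup>2"
begin

lemma M_pos: "0 < M"
  using mu_pos mu_less by simp

lemma gradient_step:
  "F (y - (1 / M) *\<^sub>R G y) \<le> F y - (norm (G y))\<^sup>2 / (2 * M)"
proof -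
  have "G y \<bullet> (y - (1 / M) *\<^sub>R G y - y) = - (norm (G y))\<^sup>2 / M"
    by (simp add: power2_norm_eq_inner)
  moreover have "M / 2 * (norm (y - (1 / M) *\<^sub>R G y - y))\<^sup>2 = (norm (G y))\<^sup>2 / (2 * M)"
    using M_pos by (simp add: power_divide field_simps power2_eq_square)
  ultimately show ?thesis
    using below[of "y - (1 / M) *\<^sub>R G y" y] by linarith
qed

lemma grad_sq_le_gap:
  assumes "\<And>y. F u \<le> F y"
  shows "(norm (G x))\<^sup>2 \<le> 2 * M * (F x - F u)"
proof -
  have "(norm (G x))\<^sup>2 / (2 * M) \<le> F x - F u"
    using gradient_step[of x] assms[of "x - (1 / M) *\<^sub>R G x"] by simp
  then show ?thesis
    using M_pos by (simp add: field_simps)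
qed

lemma minimizer_grad_zero:
  assumes "\<And>y. F u \<le> F y"
  shows "G u = 0"
  using grad_sq_le_gap[OF assms, of u] by simp

text \<open>
One step decreases \<open>F x - F u + \<mu>/2 |v - u|^2\<close> by the factor \<open>1 - q\<close>, where \<open>q = sqrt(\<mu>/M)\<close>. Writing
the current iterate as \<open>y - q d\<close>, the auxiliary point as \<open>v = y + d\<close> and the gradient as \<open>q M h\<close> removes
every division: the new iterate is \<open>y - q h\<close>, the new auxiliary point \<open>y + (1 - q) d - h\<close>. The comparison
point \<open>u\<close> is arbitrary, and the inequality is the convex combination of the lower quadratic bounds at
the iterate (weight \<open>1 - q\<close>) and at \<open>u\<close> (weight \<open>q\<close>).
\<close>

lemma potential_step:
  assumes q: "0 \<le> q" "q \<le> 1" and mu: "\<mu> = q\<^sup>2 * M" and h: "G y = (q * M) *\<^sub>R h"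
  shows "F (y - q *\<^sub>R h) - F u + \<mu> / 2 * (norm (y + (1 - q) *\<^sub>R d - h - u))\<^sup>2
       \<le> (1 - q) * (F (y - q *\<^sub>R d) - F u + \<mu> / 2 * (norm (y + d - u))\<^sup>2)"
proof -
  define b where "b = y - u"
  define m where "m = \<mu> / 2"
  have m: "0 \<le> m" "q\<^sup>2 * M = 2 * m"
    using mu_pos mu by (auto simp: m_def)
  have 1: "F (y - q *\<^sub>R h) \<le> F y - m * (h \<bullet> h)"
  proof -
    have "q *\<^sub>R h = (1 / M) *\<^sub>R G y"
      using M_pos by (simp add: h)
    moreover have "(norm (G y))\<^sup>2 / (2 * M) = q\<^sup>2 * M / 2 * (h \<bullet> h)"
      using M_pos by (simp add: h power_mult_distrib power2_norm_eq_inner) (simp add: power2_eq_square)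
    ultimately show ?thesis
      using gradient_step[of y] by (simp add: m(2))
  qed
  have 2: "F y - 2 * m * (h \<bullet> d) + m * q\<^sup>2 * (d \<bullet> d) \<le> F (y - q *\<^sub>R d)"
  proof -
    have "G y \<bullet> (y - q *\<^sub>R d - y) = - (q\<^sup>2 * M * (h \<bullet> d))"
      by (simp add: h power2_eq_square)
    moreover have "(norm (y - q *\<^sub>R d - y))\<^sup>2 = q\<^sup>2 * (d \<bullet> d)"
      by (simp add: power_mult_distrib power2_norm_eq_inner)
    ultimately show ?thesis
      using above[of y "y - q *\<^sub>R d"] m(2) by (simp add: m_def[symmetric] mult.assoc)
  qed
  have 3: "q * F y - 2 * m * (h \<bullet> b) + q * m * (b \<bullet> b) \<le> q * F u"
  proof -
    have "G y \<bullet> (u - y) = - (q * M * (h \<bullet> b))"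
      by (simp add: b_def h inner_diff_right algebra_simps)
    moreover have "(norm (u - y))\<^sup>2 = b \<bullet> b"
      by (simp add: b_def power2_norm_eq_inner[symmetric] norm_minus_commute)
    ultimately have "F y - q * M * (h \<bullet> b) + m * (b \<bullet> b) \<le> F u"
      using above[of y u] by (simp add: m_def)
    then have "q * (F y - q * M * (h \<bullet> b) + m * (b \<bullet> b)) \<le> q * F u"
      using q(1) by (rule mult_left_mono)
    moreover have "q * (F y - q * M * (h \<bullet> b) + m * (b \<bullet> b))
        = q * F y - q\<^sup>2 * M * (h \<bullet> b) + q * m * (b \<bullet> b)"
      by algebra
    ultimately show ?thesis
      unfolding m(2) by simp
  qed
  have 4: "(1 - q) * (F y - 2 * m * (h \<bullet> d) + m * q\<^sup>2 * (d \<bullet> d)) \<le> (1 - q) * F (y - q *\<^sub>R d)"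
    using q 2 by (intro mult_left_mono) auto
  have 5: "0 \<le> m * ((1 - q) * (q + q\<^sup>2) * (d \<bullet> d))"
    using q m by simp
  have e1: "(norm (y + (1 - q) *\<^sub>R d - h - u))\<^sup>2 = b \<bullet> b + (1 - q)\<^sup>2 * (d \<bullet> d) + h \<bullet> h
     + 2 * (1 - q) * (b \<bullet> d) - 2 * (h \<bullet> b) - 2 * (1 - q) * (h \<bullet> d)"
    unfolding b_def power2_norm_eq_inner
    by (simp add: algebra_simps inner_commute power2_eq_square)
  have e2: "(norm (y + d - u))\<^sup>2 = b \<bullet> b + d \<bullet> d + 2 * (b \<bullet> d)"
    unfolding b_def power2_norm_eq_inner
    by (simp add: algebra_simps inner_commute)
  \<comment> \<open>every summand on the right of the identity is nonnegative by one of these facts\<close>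
  show ?thesis
    using 1 3 4 5 potential_identity[of q "F (y - q *\<^sub>R d)" "F u" m "b \<bullet> b" "d \<bullet> d" "b \<bullet> d"
        "F (y - q *\<^sub>R h)" "h \<bullet> h" "h \<bullet> b" "h \<bullet> d" "F y"]
    unfolding e1 e2 m_def[symmetric] by linarith
qed

text \<open>
Comparing the gradient step at the extrapolated point with the previous iterate, rather than with a
minimizer, shows that the function value plus \<open>M/2\<close> times the squared last displacement does not
increase, as the momentum coefficient is at most 1 in absolute value.
\<close>

lemma energy_step:
  assumes b: "\<bar>b\<bar> \<le> 1" and y: "y = x + b *\<^sub>R e" and x': "x' = y - (1 / M) *\<^sub>R G y"
  shows "F x' + M / 2 * (norm (x' - x))\<^sup>2 \<le> F x + M / 2 * (norm e)\<^sup>2"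
proof -
  define g where "g = (1 / M) *\<^sub>R G y"
  have Gy: "G y = M *\<^sub>R g"
    using M_pos by (simp add: g_def)
  have 1: "F x' \<le> F y - M / 2 * (g \<bullet> g)"
    using gradient_step[of y] M_pos
    by (simp add: x' Gy power2_norm_eq_inner[symmetric] power_mult_distrib field_simps power2_eq_square)
  have 2: "F y - M * b * (g \<bullet> e) \<le> F x"
  proof -
    have "0 \<le> \<mu> / 2 * (norm (x - y))\<^sup>2"
      using mu_pos by simp
    then have "F y + G y \<bullet> (x - y) \<le> F x"
      using above[of y x] by linarith
    moreover have "G y \<bullet> (x - y) = - (M * b * (g \<bullet> e))"
      unfolding Gy unfolding y by simp
    ultimately show ?thesis
      by simp
  qed
  have 3: "(norm (x' - x))\<^sup>2 = b\<^sup>2 * (e \<bullet> e) - 2 * b * (g \<bullet> e) + g \<bullet> g"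
  proof -
    have "x' - x = b *\<^sub>R e - g"
      unfolding x' Gy unfolding y using M_pos by simp
    then show ?thesis
      by (simp add: power2_norm_eq_inner) (simp add: inner_diff_left inner_diff_right inner_commute power2_eq_square)
  qed
  have "b\<^sup>2 \<le> 1"
    using b by (simp add: abs_square_le_1)
  then have "M / 2 * (b\<^sup>2 * (e \<bullet> e)) \<le> M / 2 * (1 * (e \<bullet> e))"
    using M_pos by (intro mult_left_mono mult_right_mono) auto
  then show ?thesis
    using 1 2 unfolding 3 unfolding power2_norm_eq_inner by (simp add: algebra_simps)
qed

context
  fixes q \<beta> :: real and z :: 'a
  assumes q_pos: "0 < q" and q_less: "q < 1" and mu_q: "\<mu> = q\<^sup>2 * M"
    and beta: "\<beta> = (1 - q) / (1 + q)"
begin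

abbreviation "X n \<equiv> fst (agc G M \<beta> z n)"
abbreviation "Y n \<equiv> snd (agc G M \<beta> z n)"

text \<open>
The auxiliary point of the potential is recovered from the two sequences as \<open>y + (y - x) / q\<close>.
\<close>

lemma potential_contracts:
  "F (X n) - F u + \<mu> / 2 * (norm (Y n + (1 / q) *\<^sub>R (Y n - X n) - u))\<^sup>2
     \<le> (1 - q) ^ n * (F z - F u + \<mu> / 2 * (norm (z - u))\<^sup>2)"
proof (induction n)
  case (Suc n)
  define d where "d = (1 / q) *\<^sub>R (Y n - X n)"
  define h where "h = (1 / (q * M)) *\<^sub>R G (Y n)"
  have X: "X n = Y n - q *\<^sub>R d"
    using q_pos by (simp add: d_def)
  have X': "X (Suc n) = Y n - q *\<^sub>R h"
    using q_pos by (simp add: Let_def h_def)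
  have YX: "Y (Suc n) - X (Suc n) = (\<beta> * q) *\<^sub>R (d - h)"
  proof -
    have "Y (Suc n) - X (Suc n) = \<beta> *\<^sub>R (X (Suc n) - X n)"
      by (simp add: Let_def)
    also have "X (Suc n) - X n = q *\<^sub>R (d - h)"
      unfolding X X' by (simp add: algebra_simps)
    finally show ?thesis by simp
  qed
  have "b + (1 / q) *\<^sub>R (b - a) = a + ((1 + q) * \<beta>) *\<^sub>R w"
    if "b - a = (\<beta> * q) *\<^sub>R w" for a b w :: 'a
    using that q_pos by (simp add: algebra_simps)
  from this[OF YX] have "Y (Suc n) + (1 / q) *\<^sub>R (Y (Suc n) - X (Suc n))
      = X (Suc n) + ((1 + q) * \<beta>) *\<^sub>R (d - h)" .
  also have "(1 + q) * \<beta> = 1 - q"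
    using q_pos by (simp add: beta)
  finally have V': "Y (Suc n) + (1 / q) *\<^sub>R (Y (Suc n) - X (Suc n)) = Y n + (1 - q) *\<^sub>R d - h"
    unfolding X' by (simp add: algebra_simps)
  have "F (X (Suc n)) - F u + \<mu> / 2 * (norm (Y (Suc n) + (1 / q) *\<^sub>R (Y (Suc n) - X (Suc n)) - u))\<^sup>2
      \<le> (1 - q) * (F (X n) - F u + \<mu> / 2 * (norm (Y n + (1 / q) *\<^sub>R (Y n - X n) - u))\<^sup>2)"
    using potential_step[of q "Y n" h u d] q_pos q_less mu_q M_pos
    unfolding V' unfolding X' d_def[symmetric] unfolding X
    by (simp add: h_def)
  also have "\<dots> \<le> (1 - q) * ((1 - q) ^ n * (F z - F u + \<mu> / 2 * (norm (z - u))\<^sup>2))"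
    using Suc.IH q_less by (intro mult_left_mono) auto
  finally show ?case
    by simp
qed simp

text \<open>
The method may increase \<open>F\<close> from one iterate to the next, but never above its initial value: the energy
starts without kinetic part.
\<close>

lemma agc_below_start: "F (X n) \<le> F z"
proof -
  have b: "\<bar>\<beta>\<bar> \<le> 1"
    using q_pos q_less by (simp add: beta)
  \<comment> \<open>\<open>e\<close> is the last displacement, and zero initially\<close>
  have "\<exists>e. Y n = X n + \<beta> *\<^sub>R e \<and> F (X n) + M / 2 * (norm e)\<^sup>2 \<le> F z"
  proof (induction n)
    case 0
    show ?case by (rule exI[of _ 0]) simp
  next
    case (Suc n)
    then obtain e where e: "Y n = X n + \<beta> *\<^sub>R e" "F (X n) + M / 2 * (norm e)\<^sup>2 \<le> F z"
      by blast
    have "Y (Suc n) = X (Suc n) + \<beta> *\<^sub>R (X (Suc n) - X n)"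
      by (simp add: Let_def)
    moreover have "F (X (Suc n)) + M / 2 * (norm (X (Suc n) - X n))\<^sup>2 \<le> F z"
      using energy_step[OF b e(1), of "X (Suc n)"] e(2) by (simp add: Let_def)
    ultimately show ?case by blast
  qed
  then obtain e where "Y n = X n + \<beta> *\<^sub>R e" and "F (X n) + M / 2 * (norm e)\<^sup>2 \<le> F z"
    by blast
  note this(2)
  moreover have "0 \<le> M / 2 * (norm e)\<^sup>2"
    using M_pos by simp
  ultimately show ?thesis by linarith
qed

lemma agc_gap_le:
  assumes u: "\<And>y. F u \<le> F y"
  shows "F (X n) - F u \<le> (1 - q) ^ n * ((M + \<mu>) / 2 * (norm (z - u))\<^sup>2)"
proof -
  have "F z - F u \<le> M / 2 * (norm (z - u))\<^sup>2"
    using below[of z u] minimizer_grad_zero[OF u] by simp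
  then have "(1 - q) ^ n * (F z - F u + \<mu> / 2 * (norm (z - u))\<^sup>2)
      \<le> (1 - q) ^ n * ((M + \<mu>) / 2 * (norm (z - u))\<^sup>2)"
    using q_less by (intro mult_left_mono) (auto simp: algebra_simps add_divide_distrib)
  moreover have "0 \<le> \<mu> / 2 * (norm (Y n + (1 / q) *\<^sub>R (Y n - X n) - u))\<^sup>2"
    using mu_pos by simp
  ultimately show ?thesis
    using potential_contracts[of n u] by linarith
qed

end

lemma dist_sq_le_gap:
  assumes u: "\<And>y. F u \<le> F y"
  shows "(norm (x - u))\<^sup>2 \<le> 2 / \<mu> * (F x - F u)"
proof -
  have "\<mu> / 2 * (norm (x - u))\<^sup>2 \<le> F x - F u"
    using above[of u x] minimizer_grad_zero[OF u] by simp
  then have "2 / \<mu> * (\<mu> / 2 * (norm (x - u))\<^sup>2) \<le> 2 / \<mu> * (F x - F u)"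
    using mu_pos by (intro mult_left_mono) auto
  then show ?thesis
    using mu_pos by simp
qed

end

section \<open>Convex smooth problems and their proximal regularization\<close>

lemma reg_fun_GDERIV:
  fixes f :: "'a::euclidean_space \<Rightarrow> real"
  assumes "f differentiable (at x)"
  shows "GDERIV (reg_fun f \<delta> z) x :> grad f x + \<delta> *\<^sub>R (x - z)"
proof -
  have "((\<lambda>x. \<delta> / 2 * ((x - z) \<bullet> (x - z))) has_derivative (\<lambda>h. h \<bullet> (\<delta> *\<^sub>R (x - z)))) (at x)"
    by (auto intro!: derivative_eq_intros simp: fun_eq_iff inner_commute)
  then have "((\<lambda>x. f x + \<delta> / 2 * ((x - z) \<bullet> (x - z))) has_derivative
      (\<lambda>h. h \<bullet> grad f x + h \<bullet> (\<delta> *\<^sub>R (x - z)))) (at x)"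
    using GDERIV_grad[OF assms] unfolding gderiv_def by (intro has_derivative_add)
  then show ?thesis
    unfolding reg_fun_def gderiv_def power2_norm_eq_inner by (simp add: inner_add_right)
qed

locale convex_smooth_problem =
  fixes f :: "'a::euclidean_space \<Rightarrow> real" and L :: real
  assumes convex: "convex_on UNIV f" and L_pos: "0 < L" and smooth: "smooth_fun L f"
    and minimizers_nonempty: "minimizers f \<noteq> {}"
begin

lemma differentiable: "f differentiable (at x)"
  using smooth unfolding smooth_fun_def by blast

lemma grad_lipschitz: "norm (grad f x - grad f y) \<le> L * norm (x - y)"
  using smooth unfolding smooth_fun_def by blast

lemma continuous: "continuous_on S f"
  by (intro continuous_at_imp_continuous_on) (auto intro: differentiable_imp_continuous_within differentiable)

lemma min_value_eq:
  assumes "u \<in> minimizers f"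
  shows "min_value f = f u"
  unfolding min_value_def using assms
  by (intro cInf_eq_minimum) (auto simp: minimizers_def)

lemma min_value_le: "min_value f \<le> f x"
proof -
  obtain u where "u \<in> minimizers f"
    using minimizers_nonempty by blast
  then show ?thesis
    using min_value_eq by (auto simp: minimizers_def)
qed

lemma grad_minimizer:
  assumes "u \<in> minimizers f"
  shows "grad f u = 0"
proof -
  define y where "y = u - (1 / L) *\<^sub>R grad f u"
  have "grad f u \<bullet> (y - u) = - (norm (grad f u))\<^sup>2 / L"
    by (simp add: y_def power2_norm_eq_inner)
  moreover have "L / 2 * (norm (y - u))\<^sup>2 = (norm (grad f u))\<^sup>2 / (2 * L)"
    using L_pos by (simp add: y_def power_divide field_simps power2_eq_square)
  ultimately have "f u \<le> f u + - (norm (grad f u))\<^sup>2 / L + (norm (grad f u))\<^sup>2 / (2 * L)"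
    using smooth_below_quadratic[OF smooth, of y u] assms
    unfolding minimizers_def by (metis (mono_tags) mem_Collect_eq order_trans)
  then show ?thesis
    using L_pos by (simp add: field_simps)
qed

lemma nearest_minimizer:
  obtains u where "u \<in> minimizers f" and "infdist x (minimizers f) = norm (x - u)"
proof -
  have "closed {x. \<forall>y. f x \<le> f y}"
    by (intro closed_Collect_all closed_Collect_le continuous continuous_on_const)
  then have "closed (minimizers f)"
    unfolding minimizers_def .
  then show thesis
    using infdist_attains_inf[of "minimizers f" x] minimizers_nonempty that
    by (metis dist_norm)
qed

lemma grad_le_infdist: "norm (grad f x) \<le> L * infdist x (minimizers f)"
proof -
  obtain u where u: "u \<in> minimizers f" "infdist x (minimizers f) = norm (x - u)"
    by (rule nearest_minimizer)
  show ?thesis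
    using grad_lipschitz[of x u] grad_minimizer[OF u(1)] u(2) by simp
qed

lemma gap_le_grad_infdist: "f x - min_value f \<le> norm (grad f x) * infdist x (minimizers f)"
proof -
  obtain u where u: "u \<in> minimizers f" "infdist x (minimizers f) = norm (x - u)"
    by (rule nearest_minimizer)
  have "f x - f u \<le> grad f x \<bullet> (x - u)"
    using convex_above_tangent[OF convex differentiable, of x u] by (simp add: inner_diff_right)
  also have "\<dots> \<le> norm (grad f x) * norm (x - u)"
    by (rule norm_cauchy_schwarz)
  finally show ?thesis
    using min_value_eq[OF u(1)] u(2) by simp
qed

text \<open>
The error bound controls the distance \<open>D\<close> by the function gap, which convexity bounds by \<open>e D\<close>. Solving
\<open>D \<le> c (e D)^\<theta>\<close> for \<open>D\<close> gives a bound by the gradient alone.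
\<close>

lemma HEB_infdist_le:
  assumes heb: "infdist x (minimizers f) \<le> c * (f x - min_value f) powr \<theta>"
    and \<theta>: "0 < \<theta>" "\<theta> < 1" and c: "0 < c" and e: "norm (grad f x) \<le> e"
  shows "infdist x (minimizers f) \<le> c powr (1 / (1 - \<theta>)) * e powr (\<theta> / (1 - \<theta>))"
proof (cases "infdist x (minimizers f) = 0")
  case False
  define D where "D = infdist x (minimizers f)"
  have D: "0 < D"
    using False infdist_nonneg[of x "minimizers f"] by (simp add: D_def)
  have e0: "0 \<le> e"
    using e norm_ge_zero order_trans by blast
  have "f x - min_value f \<le> e * D"
    using gap_le_grad_infdist[of x] mult_right_mono[OF e, of D] D unfolding D_def by linarith
  then have "(f x - min_value f) powr \<theta> \<le> (e * D) powr \<theta>"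
    using min_value_le[of x] \<theta> by (intro powr_mono2) auto
  then have "D \<le> c * (e * D) powr \<theta>"
    using heb mult_left_mono[OF _ less_imp_le[OF c]] unfolding D_def by fastforce
  also have "\<dots> = c * e powr \<theta> * D powr \<theta>"
    using e0 D by (simp add: powr_mult)
  finally have "D * D powr (- \<theta>) \<le> c * e powr \<theta> * D powr \<theta> * D powr (- \<theta>)"
    by (intro mult_right_mono) auto
  then have "D powr (1 - \<theta>) \<le> c * e powr \<theta>"
    using D by (simp add: mult.assoc powr_add[symmetric] powr_mult_base)
  then have "(D powr (1 - \<theta>)) powr (1 / (1 - \<theta>)) \<le> (c * e powr \<theta>) powr (1 / (1 - \<theta>))"
    using \<theta> by (intro powr_mono2) auto
  then show ?thesis
    using \<theta> c D e0 by (simp add: D_def powr_powr powr_mult)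
qed (use assms in auto)

text \<open>
Smoothness and the error bound compete, so that \<open>L\<close>, \<open>c\<close> and the gradient norm cannot be independent.
This makes \<open>\<delta> \<le> L/6\<close> once the estimate of \<open>c\<close> is large enough, and it keeps the logarithm in the
iteration bound nonnegative.
\<close>

lemma HEB_grad_powr_le:
  assumes heb: "infdist x (minimizers f) \<le> c * (f x - min_value f) powr \<theta>"
    and \<theta>: "0 < \<theta>" "\<theta> < 1" and c: "0 < c" and pos: "0 < norm (grad f x)"
  shows "norm (grad f x) powr ((1 - 2 * \<theta>) / (1 - \<theta>)) \<le> L * c powr (1 / (1 - \<theta>))"
proof -
  define g where "g = norm (grad f x)"
  have g: "0 < g"
    using pos by (simp add: g_def)
  have "g \<le> L * infdist x (minimizers f)"
    using grad_le_infdist by (simp add: g_def)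
  also have "\<dots> \<le> L * (c powr (1 / (1 - \<theta>)) * g powr (\<theta> / (1 - \<theta>)))"
    using HEB_infdist_le[OF heb \<theta> c order_refl] L_pos by (simp add: g_def)
  finally have "g * g powr (- (\<theta> / (1 - \<theta>)))
      \<le> L * (c powr (1 / (1 - \<theta>)) * g powr (\<theta> / (1 - \<theta>))) * g powr (- (\<theta> / (1 - \<theta>)))"
    by (intro mult_right_mono) auto
  then have "g powr (1 - \<theta> / (1 - \<theta>)) \<le> L * c powr (1 / (1 - \<theta>))"
    using g by (simp add: mult.assoc powr_add[symmetric] powr_mult_base)
  moreover have "1 - \<theta> / (1 - \<theta>) = (1 - 2 * \<theta>) / (1 - \<theta>)"
    using \<theta> by (simp add: field_simps)
  ultimately show ?thesis
    by (simp add: g_def)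
qed

lemma grad_reg_fun: "grad (reg_fun f \<delta> z) x = grad f x + \<delta> *\<^sub>R (x - z)"
  by (rule grad_eqI[OF reg_fun_GDERIV[OF differentiable]])

lemma reg_fun_strongly_convex_smooth:
  assumes "0 < \<delta>"
  shows "strongly_convex_smooth (reg_fun f \<delta> z) (grad (reg_fun f \<delta> z)) \<delta> (L + \<delta>)"
proof
  fix x y
  have *: "\<delta> / 2 * (norm (y - z))\<^sup>2 =
      \<delta> / 2 * (norm (x - z))\<^sup>2 + \<delta> *\<^sub>R (x - z) \<bullet> (y - x) + \<delta> / 2 * (norm (y - x))\<^sup>2"
    by (simp add: power2_norm_eq_inner algebra_simps inner_commute add_divide_distrib)
  show "reg_fun f \<delta> z x + grad (reg_fun f \<delta> z) x \<bullet> (y - x) + \<delta> / 2 * (norm (y - x))\<^sup>2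
      \<le> reg_fun f \<delta> z y"
    using convex_above_tangent[OF convex differentiable, of x y]
    unfolding reg_fun_def grad_reg_fun * inner_add_left by simp
  show "reg_fun f \<delta> z y
      \<le> reg_fun f \<delta> z x + grad (reg_fun f \<delta> z) x \<bullet> (y - x) + (L + \<delta>) / 2 * (norm (y - x))\<^sup>2"
    using smooth_below_quadratic[OF smooth, of y x]
    unfolding reg_fun_def grad_reg_fun * inner_add_left by (simp add: add_divide_distrib distrib_right)
qed (use assms L_pos in auto)

text \<open>
Outside the ball of radius \<open>r\<close> the quadratic term alone exceeds the gap \<open>f z - min_value f\<close>, so a minimizer
over the compact ball is a global one.
\<close>

lemma reg_fun_minimizer:
  assumes "0 < \<delta>"
  obtains u where "\<And>y. reg_fun f \<delta> z u \<le> reg_fun f \<delta> z y"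
proof -
  define r where "r = sqrt (2 / \<delta> * (f z - min_value f))"
  have r: "0 \<le> r" "\<delta> / 2 * r\<^sup>2 = f z - min_value f"
    using assms min_value_le[of z] by (auto simp: r_def)
  have "continuous_on (cball z r) (reg_fun f \<delta> z)"
    unfolding reg_fun_def by (intro continuous_intros continuous)
  moreover have "cball z r \<noteq> {}"
    using r by simp
  ultimately obtain u where u: "u \<in> cball z r" "\<And>y. y \<in> cball z r \<Longrightarrow> reg_fun f \<delta> z u \<le> reg_fun f \<delta> z y"
    using continuous_attains_inf[OF compact_cball] by metis
  have "reg_fun f \<delta> z u \<le> reg_fun f \<delta> z y" for y
  proof (cases "y \<in> cball z r")
    case False
    then have "r\<^sup>2 \<le> (norm (y - z))\<^sup>2"
      using r by (intro power_mono) (auto simp: dist_norm norm_minus_commute)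
    then have "f z - min_value f \<le> \<delta> / 2 * (norm (y - z))\<^sup>2"
      using assms unfolding r(2)[symmetric] by (intro mult_left_mono) auto
    then have "reg_fun f \<delta> z z \<le> reg_fun f \<delta> z y"
      using min_value_le[of y] by (simp add: reg_fun_def)
    then show ?thesis
      using u(2)[of z] r by simp
  qed (use u in auto)
  then show thesis
    by (rule that)
qed

text \<open>
Against the nearest minimizer \<open>w\<close> of \<open>f\<close>, the point \<open>u\<close> cannot win in the values of \<open>f\<close>, hence it does not
lose in the quadratic term.
\<close>

lemma proximal_point_dist_le:
  assumes "0 < \<delta>" and u: "\<And>y. reg_fun f \<delta> z u \<le> reg_fun f \<delta> z y"
  shows "norm (z - u) \<le> infdist z (minimizers f)"
proof -
  obtain w where w: "w \<in> minimizers f" "infdist z (minimizers f) = norm (z - w)"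
    by (rule nearest_minimizer)
  have "f w \<le> f u"
    using w(1) by (simp add: minimizers_def)
  then have "\<delta> / 2 * (norm (u - z))\<^sup>2 \<le> \<delta> / 2 * (norm (w - z))\<^sup>2"
    using u[of w] unfolding reg_fun_def by linarith
  then have "(norm (u - z))\<^sup>2 \<le> (norm (w - z))\<^sup>2"
    using assms(1) by simp
  then show ?thesis
    using w(2) by (simp add: norm_minus_commute power2_le_iff_abs_le)
qed

section \<open>A cycle of the accelerated method\<close>

definition momentum :: "real \<Rightarrow> real" where
  "momentum \<delta> = (sqrt (L + \<delta>) - sqrt \<delta>) / (sqrt (L + \<delta>) + sqrt \<delta>)"

definition cycle_iterate :: "real \<Rightarrow> 'a \<Rightarrow> nat \<Rightarrow> 'a \<times> 'a" where
  "cycle_iterate \<delta> z = agc (grad (reg_fun f \<delta> z)) (L + \<delta>) (momentum \<delta>) z"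

text \<open>
The momentum coefficient is the one that Nesterov's scheme prescribes for modulus \<open>\<delta>\<close> and smoothness
\<open>L + \<delta>\<close>.
\<close>

lemma momentum_parameters:
  assumes "0 < \<delta>"
  shows "0 < sqrt (\<delta> / (L + \<delta>))" and "sqrt (\<delta> / (L + \<delta>)) < 1"
    and "\<delta> = (sqrt (\<delta> / (L + \<delta>)))\<^sup>2 * (L + \<delta>)"
    and "momentum \<delta> = (1 - sqrt (\<delta> / (L + \<delta>))) / (1 + sqrt (\<delta> / (L + \<delta>)))"
proof -
  have s: "0 < sqrt \<delta>" "0 < sqrt (L + \<delta>)"
    using assms L_pos by auto
  have "(b - a) / (b + a) = (1 - a / b) / (1 + a / b)" if "0 < a" "0 < b" for a b :: real
  proof -
    have "1 - a / b = (b - a) / b" "1 + a / b = (b + a) / b"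
      using that by (auto simp: field_simps)
    then show ?thesis
      using that by simp
  qed
  from this[OF s] show "momentum \<delta> = (1 - sqrt (\<delta> / (L + \<delta>))) / (1 + sqrt (\<delta> / (L + \<delta>)))"
    unfolding momentum_def real_sqrt_divide .
qed (use assms L_pos in \<open>auto simp: field_simps\<close>)

text \<open>
The regularization vanishes at the centre and is nonnegative elsewhere, so the comparison with the start
of the iteration carries over from the regularized function to \<open>f\<close>.
\<close>

lemma cycle_iterate_descends:
  assumes "0 < \<delta>"
  shows "f (fst (cycle_iterate \<delta> z n)) \<le> f z"
proof -
  interpret strongly_convex_smooth "reg_fun f \<delta> z" "grad (reg_fun f \<delta> z)" \<delta> "L + \<delta>"
    by (rule reg_fun_strongly_convex_smooth[OF assms])
  have "reg_fun f \<delta> z (fst (cycle_iterate \<delta> z n)) \<le> reg_fun f \<delta> z z"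
    unfolding cycle_iterate_def by (rule agc_below_start[OF momentum_parameters[OF assms]])
  moreover have "0 \<le> \<delta> / 2 * (norm (fst (cycle_iterate \<delta> z n) - z))\<^sup>2"
    using assms by simp
  ultimately show ?thesis
    by (simp add: reg_fun_def)
qed

text \<open>
The cycle length is chosen for this: it is at least \<open>(2 / q) ln a\<close> with \<open>a = sqrt(L (L + \<delta>)) / \<delta>\<close>, so
that \<open>(1 - q)^n \<le> exp(-q n) \<le> 1 / a^2\<close>.
\<close>

lemma cycle_rate:
  assumes \<delta>: "0 < \<delta>" and n: "adaAGC_cycle_length L \<delta> \<le> int n"
  shows "(1 - sqrt (\<delta> / (L + \<delta>))) ^ n \<le> \<delta>\<^sup>2 / (L * (L + \<delta>))"
proof -
  define q where "q = sqrt (\<delta> / (L + \<delta>))"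
  note q = momentum_parameters[OF \<delta>, folded q_def]
  define a where "a = sqrt (L * (L + \<delta>)) / \<delta>"
  have a: "0 < a" "a\<^sup>2 = L * (L + \<delta>) / \<delta>\<^sup>2"
    using \<delta> L_pos by (auto simp: a_def power_divide)
  have "2 * sqrt ((L + \<delta>) / \<delta>) * ln a \<le> real_of_int (adaAGC_cycle_length L \<delta>)"
    unfolding adaAGC_cycle_length_def a_def by (rule le_of_int_ceiling)
  also have "\<dots> \<le> real n"
    using n by linarith
  finally have "2 * (sqrt ((L + \<delta>) / \<delta>) * q) * ln a \<le> real n * q"
    using mult_right_mono[of _ "real n" q] q(1) by (fastforce simp: mult.assoc mult.left_commute mult.commute)
  moreover have "sqrt ((L + \<delta>) / \<delta>) * q = 1"
    unfolding q_def real_sqrt_mult[symmetric] using \<delta> L_pos by simp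
  ultimately have 1: "2 * ln a \<le> real n * q"
    by simp
  have "(1 - q) ^ n \<le> exp (- q) ^ n"
    using q exp_ge_add_one_self[of "- q"] by (intro power_mono) auto
  also have "\<dots> = exp (- (real n * q))"
    by (simp add: exp_of_nat_mult[symmetric])
  also have "\<dots> \<le> exp (- (2 * ln a))"
    using 1 by simp
  also have "\<dots> = 1 / a\<^sup>2"
    using a(1) by (simp add: exp_minus exp_double inverse_eq_divide)
  also have "\<dots> = \<delta>\<^sup>2 / (L * (L + \<delta>))"
    using a(2) by simp
  finally show ?thesis
    by (simp add: q_def)
qed

text \<open>
Let \<open>u\<close> minimize the regularized function and \<open>R = |z - u|\<close>. The gradient of \<open>f\<close> at the last iterate \<open>x\<close>
differs from that of the regularized function by \<open>\<delta> (x - z)\<close>. The gap left after the cycle is so small that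
the regularized gradient at \<open>x\<close> is at most \<open>6/5 \<delta> R\<close> and \<open>|x - u|\<close> at most \<open>3/5 R\<close>. Together this
gives \<open>6/5 \<delta> R + \<delta> (3/5 R + R) = 14/5 \<delta> R\<close>, and \<open>R\<close> is at most the distance to the minimizers.
\<close>

lemma cycle_grad_le:
  assumes \<delta>: "0 < \<delta>" "\<delta> \<le> L / 6" and n: "adaAGC_cycle_length L \<delta> \<le> int n"
  shows "norm (grad f (fst (cycle_iterate \<delta> z n))) \<le> 3 * \<delta> * infdist z (minimizers f)"
proof -
  interpret strongly_convex_smooth "reg_fun f \<delta> z" "grad (reg_fun f \<delta> z)" \<delta> "L + \<delta>"
    by (rule reg_fun_strongly_convex_smooth[OF \<delta>(1)])
  obtain u where u: "\<And>y. reg_fun f \<delta> z u \<le> reg_fun f \<delta> z y"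
    using reg_fun_minimizer[OF \<delta>(1)] by blast
  define R where "R = norm (z - u)"
  define x where "x = fst (cycle_iterate \<delta> z n)"
  define gap where "gap = reg_fun f \<delta> z x - reg_fun f \<delta> z u"
  have "gap \<le> (1 - sqrt (\<delta> / (L + \<delta>))) ^ n * ((L + \<delta> + \<delta>) / 2 * R\<^sup>2)"
    unfolding gap_def x_def R_def cycle_iterate_def
    by (rule agc_gap_le[OF momentum_parameters[OF \<delta>(1)] u])
  also have "\<dots> \<le> \<delta>\<^sup>2 / (L * (L + \<delta>)) * ((L + \<delta> + \<delta>) / 2 * R\<^sup>2)"
    using \<delta> L_pos by (intro mult_right_mono cycle_rate n) auto
  finally have gap: "gap \<le> \<delta>\<^sup>2 / (L * (L + \<delta>)) * ((L + \<delta> + \<delta>) / 2 * R\<^sup>2)" .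
  have "(norm (grad (reg_fun f \<delta> z) x))\<^sup>2 \<le> 2 * (L + \<delta>) * gap"
    unfolding gap_def by (rule grad_sq_le_gap[OF u])
  also have "\<dots> \<le> 2 * (L + \<delta>) * (\<delta>\<^sup>2 / (L * (L + \<delta>)) * ((L + \<delta> + \<delta>) / 2 * R\<^sup>2))"
    using gap \<delta> L_pos by (intro mult_left_mono) auto
  also have "\<dots> = (L + \<delta> + \<delta>) / L * (\<delta> * R)\<^sup>2"
  proof -
    have "2 * M * (\<delta>\<^sup>2 / (L * M) * ((M + \<delta>) / 2 * R\<^sup>2)) = (M + \<delta>) / L * (\<delta> * R)\<^sup>2"
      if "0 < M" for M
      using that L_pos by (simp add: power_mult_distrib field_simps)
    from this[OF M_pos] show ?thesis .
  qed
  also have "\<dots> \<le> (6 / 5)\<^sup>2 * (\<delta> * R)\<^sup>2"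
  proof (rule mult_right_mono)
    show "(L + \<delta> + \<delta>) / L \<le> (6 / 5)\<^sup>2"
      using \<delta> L_pos by (simp add: field_simps power2_eq_square)
  qed simp
  finally have "(norm (grad (reg_fun f \<delta> z) x))\<^sup>2 \<le> (6 / 5 * (\<delta> * R))\<^sup>2"
    by (simp only: power_mult_distrib[of "6 / 5"])
  then have 1: "norm (grad (reg_fun f \<delta> z) x) \<le> 6 / 5 * (\<delta> * R)"
    by (rule power2_le_imp_le) (use \<delta> in \<open>auto simp: R_def\<close>)
  have "(norm (x - u))\<^sup>2 \<le> 2 / \<delta> * gap"
    unfolding gap_def by (rule dist_sq_le_gap[OF u])
  also have "\<dots> \<le> 2 / \<delta> * (\<delta>\<^sup>2 / (L * (L + \<delta>)) * ((L + \<delta> + \<delta>) / 2 * R\<^sup>2))"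
    using gap \<delta> L_pos by (intro mult_left_mono) auto
  also have "\<dots> = (\<delta> / L * ((L + \<delta> + \<delta>) / (L + \<delta>))) * R\<^sup>2"
  proof -
    have "2 / \<delta> * (\<delta>\<^sup>2 / (L * M) * ((M + \<delta>) / 2 * R\<^sup>2)) = (\<delta> / L * ((M + \<delta>) / M)) * R\<^sup>2"
      if "0 < M" for M
      using that L_pos \<delta> by (simp add: power2_eq_square field_simps)
    from this[OF M_pos] show ?thesis .
  qed
  also have "\<dots> \<le> (1 / 6 * 2) * R\<^sup>2"
  proof (rule mult_right_mono)
    show "\<delta> / L * ((L + \<delta> + \<delta>) / (L + \<delta>)) \<le> 1 / 6 * 2"
      using \<delta> L_pos by (intro mult_mono) (auto simp: field_simps)
  qed simp
  also have "\<dots> \<le> (3 / 5)\<^sup>2 * R\<^sup>2"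
    by (intro mult_right_mono) (auto simp: power2_eq_square)
  finally have "(norm (x - u))\<^sup>2 \<le> (3 / 5 * R)\<^sup>2"
    by (simp only: power_mult_distrib)
  then have 2: "norm (x - u) \<le> 3 / 5 * R"
    by (rule power2_le_imp_le) (simp add: R_def)
  have "norm (x - z) \<le> norm (x - u) + R"
    using norm_triangle_ineq[of "x - u" "u - z"] by (simp add: R_def norm_minus_commute)
  then have "norm (x - z) \<le> 8 / 5 * R"
    using 2 by simp
  then have "\<delta> * norm (x - z) \<le> \<delta> * (8 / 5 * R)"
    using \<delta> by (intro mult_left_mono) auto
  also have "\<dots> = 8 / 5 * (\<delta> * R)"
    by simp
  finally have 3: "\<delta> * norm (x - z) \<le> 8 / 5 * (\<delta> * R)" .
  have "0 \<le> \<delta> * R"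
    using \<delta> by (simp add: R_def)
  have "norm (grad f x) \<le> norm (grad (reg_fun f \<delta> z) x) + \<delta> * norm (x - z)"
    unfolding grad_reg_fun using norm_triangle_ineq4[of "grad f x + \<delta> *\<^sub>R (x - z)" "\<delta> *\<^sub>R (x - z)"] \<delta>
    by simp
  also have "\<dots> \<le> 3 * \<delta> * R"
    using 1 3 \<open>0 \<le> \<delta> * R\<close> unfolding mult.assoc by linarith
  also have "\<dots> \<le> 3 * \<delta> * infdist z (minimizers f)"
    using proximal_point_dist_le[OF \<delta>(1) u] \<delta> by (simp add: R_def)
  finally show ?thesis
    by (simp add: x_def)
qed

text \<open>
With \<open>ce \<ge> c\<close> the definition of \<open>\<delta>\<close> gives \<open>\<delta> D(z) \<le> e / 6\<close>: the powers of \<open>e\<close> coming from \<open>\<delta>\<close> and from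
the distance bound have exponents that add up to 1.
\<close>

lemma cycle_succeeds:
  assumes heb: "infdist z (minimizers f) \<le> c * (f z - min_value f) powr \<theta>"
    and \<theta>: "0 < \<theta>" "\<theta> < 1" and c: "0 < c" "c \<le> ce"
    and e: "0 < e" "norm (grad f z) \<le> e"
    and small: "adaAGC_delta \<theta> e ce \<le> L / 6"
    and n: "adaAGC_cycle_length L (adaAGC_delta \<theta> e ce) \<le> int n"
  shows "norm (grad f (fst (cycle_iterate (adaAGC_delta \<theta> e ce) z n))) \<le> e / 2"
proof -
  define \<delta> where "\<delta> = adaAGC_delta \<theta> e ce"
  have \<delta>: "0 < \<delta>"
    using e c by (simp add: \<delta>_def adaAGC_delta_def)
  have "infdist z (minimizers f) \<le> c powr (1 / (1 - \<theta>)) * e powr (\<theta> / (1 - \<theta>))"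
    by (rule HEB_infdist_le[OF heb \<theta> c(1) e(2)])
  also have "\<dots> \<le> ce powr (1 / (1 - \<theta>)) * e powr (\<theta> / (1 - \<theta>))"
    using c \<theta> by (intro mult_right_mono powr_mono2) auto
  finally have "\<delta> * infdist z (minimizers f) \<le> \<delta> * (ce powr (1 / (1 - \<theta>)) * e powr (\<theta> / (1 - \<theta>)))"
    using \<delta> by simp
  also have "\<dots> = e powr ((1 - 2 * \<theta>) / (1 - \<theta>)) * e powr (\<theta> / (1 - \<theta>)) / 6"
    using c by (simp add: \<delta>_def adaAGC_delta_def)
  also have "\<dots> = e powr ((1 - 2 * \<theta>) / (1 - \<theta>) + \<theta> / (1 - \<theta>)) / 6"
    by (simp add: powr_add)
  also have "(1 - 2 * \<theta>) / (1 - \<theta>) + \<theta> / (1 - \<theta>) = 1"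
    using \<theta> by (simp add: add_divide_distrib[symmetric])
  finally have "\<delta> * infdist z (minimizers f) \<le> e / 6"
    using e by simp
  then show ?thesis
    using cycle_grad_le[OF \<delta> small[folded \<delta>_def] n[folded \<delta>_def], of z] by (simp add: \<delta>_def)
qed

end

section \<open>The run of the adaptive method\<close>

text \<open>
The largest number of iterations that a cycle can perform: even if the prescribed length is not positive,
one iteration is carried out before the length is tested.
\<close>

definition cycle_cap :: "real \<Rightarrow> real \<Rightarrow> nat" where
  "cycle_cap L \<delta> = max 1 (nat (adaAGC_cycle_length L \<delta>))"

context convex_smooth_problem
begin

text \<open>
The states that occur in a run are those reached after \<open>n\<close> iterations of a cycle that depends only on the
centre, the tolerance and the estimate of \<open>c\<close>.
\<close>

definition cycle_state :: "real \<Rightarrow> nat \<Rightarrow> 'a \<Rightarrow> real \<Rightarrow> real \<Rightarrow> nat \<Rightarrow> 'a adaAGC_state" where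
  "cycle_state \<theta> k z e ce n =
     \<lparr>stages_done = k, center = z, eps = e, cest = ce, tau = Suc n,
      xcur = fst (cycle_iterate (adaAGC_delta \<theta> e ce) z n),
      ycur = snd (cycle_iterate (adaAGC_delta \<theta> e ce) z n)\<rparr>"

lemma adaAGC_init_eq: "adaAGC_init f x0 c0 = cycle_state \<theta> 0 x0 (norm (grad f x0)) c0 0"
  by (simp add: adaAGC_init_def cycle_state_def cycle_iterate_def)

lemma adaAGC_step_cycle_state:
  fixes \<theta> e ce :: real and z :: 'a
  defines "\<delta> \<equiv> adaAGC_delta \<theta> e ce"
  defines "x' n \<equiv> fst (cycle_iterate \<delta> z n)"
  shows "adaAGC_step f L \<theta> \<gamma> (cycle_state \<theta> k z e ce n) =
    (if norm (grad f (x' (Suc n))) \<le> e / 2 then cycle_state \<theta> (Suc k) (x' (Suc n)) (e / 2) ce 0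
     else if adaAGC_cycle_length L \<delta> \<le> int (Suc n) then cycle_state \<theta> k z e (\<gamma> * ce) 0
     else cycle_state \<theta> k z e ce (Suc n))"
  unfolding x'_def \<delta>_def adaAGC_step_def cycle_state_def cycle_iterate_def momentum_def
  by (simp add: Let_def)

lemma stages_done_cycle_state [simp]: "stages_done (cycle_state \<theta> k z e ce n) = k"
  and center_cycle_state [simp]: "center (cycle_state \<theta> k z e ce n) = z"
  by (simp_all add: cycle_state_def)

text \<open>
Inside a cycle the algorithm follows the accelerated iteration until the first step at which one of the two
tests fires. Either the stage is completed, or the same stage is restarted with a larger estimate, and
then the gradient test failed although the prescribed length was reached.
\<close>

lemma cycle_outcome:
  fixes \<theta> \<gamma> e ce :: real and z :: 'a and k :: nat
  defines "\<delta> \<equiv> adaAGC_delta \<theta> e ce"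
  defines "x' n \<equiv> fst (cycle_iterate \<delta> z n)"
  defines "run n \<equiv> (adaAGC_step f L \<theta> \<gamma> ^^ n) (cycle_state \<theta> k z e ce 0)"
  obtains n where "n \<le> cycle_cap L \<delta>" and "\<And>j. j < n \<Longrightarrow> stages_done (run j) = k"
    and "norm (grad f (x' n)) \<le> e / 2" and "run n = cycle_state \<theta> (Suc k) (x' n) (e / 2) ce 0"
  | n where "n \<le> cycle_cap L \<delta>" and "\<And>j. j < n \<Longrightarrow> stages_done (run j) = k"
    and "\<not> norm (grad f (x' n)) \<le> e / 2" and "adaAGC_cycle_length L \<delta> \<le> int n"
    and "run n = cycle_state \<theta> k z e (\<gamma> * ce) 0"
proof -
  define stop where
    "stop n \<longleftrightarrow> norm (grad f (x' (Suc n))) \<le> e / 2 \<or> adaAGC_cycle_length L \<delta> \<le> int (Suc n)" for n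
  have cap: "stop (cycle_cap L \<delta> - 1)"
    unfolding stop_def cycle_cap_def by auto
  \<comment> \<open>\<open>stop m\<close> means that iteration \<open>m + 1\<close> is the last one of the cycle\<close>
  define m where "m = (LEAST m. stop m)"
  have m: "stop m"
    unfolding m_def using cap by (rule LeastI)
  have "m \<le> cycle_cap L \<delta> - 1"
    unfolding m_def using cap by (rule Least_le)
  moreover have "1 \<le> cycle_cap L \<delta>"
    by (simp add: cycle_cap_def)
  ultimately have le: "Suc m \<le> cycle_cap L \<delta>"
    by simp
  have before: "run j = cycle_state \<theta> k z e ce j" if "j \<le> m" for j
    using that
  proof (induction j)
    case (Suc j)
    have "j < m"
      using Suc.prems by simp
    then have "\<not> stop j"
      unfolding m_def by (rule not_less_Least)
    moreover have "run (Suc j) = adaAGC_step f L \<theta> \<gamma> (cycle_state \<theta> k z e ce j)"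
      using Suc by (simp add: run_def)
    ultimately show ?case
      unfolding stop_def x'_def \<delta>_def adaAGC_step_cycle_state by simp
  qed (simp add: run_def)
  then have inside: "stages_done (run j) = k" if "j < Suc m" for j
    using that by simp
  have last: "run (Suc m) = adaAGC_step f L \<theta> \<gamma> (cycle_state \<theta> k z e ce m)"
    using before[of m] by (simp add: run_def)
  show thesis
  proof (cases "norm (grad f (x' (Suc m))) \<le> e / 2")
    case True
    then have "run (Suc m) = cycle_state \<theta> (Suc k) (x' (Suc m)) (e / 2) ce 0"
      unfolding last x'_def \<delta>_def adaAGC_step_cycle_state by simp
    then show thesis
      using that(1)[OF le inside True] by blast
  next
    case False
    then have len: "adaAGC_cycle_length L \<delta> \<le> int (Suc m)"
      using m by (simp add: stop_def)
    then have "run (Suc m) = cycle_state \<theta> k z e (\<gamma> * ce) 0"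
      using False unfolding last x'_def \<delta>_def adaAGC_step_cycle_state by simp
    then show thesis
      using that(2)[OF le inside False len] by blast
  qed
qed

text \<open>
The run from an arbitrary state completes its \<open>K\<close>-th stage after at most \<open>b\<close> iterations, with output
gradient at most \<open>e\<close>. Starting from arbitrary states makes runs composable.
\<close>

definition halts_within :: "real \<Rightarrow> real \<Rightarrow> nat \<Rightarrow> real \<Rightarrow> 'a adaAGC_state \<Rightarrow> real \<Rightarrow> bool" where
  "halts_within \<theta> \<gamma> K e s b \<longleftrightarrow>
     (\<exists>N x. stages_done ((adaAGC_step f L \<theta> \<gamma> ^^ N) s) = K \<and>
        (\<forall>n<N. stages_done ((adaAGC_step f L \<theta> \<gamma> ^^ n) s) < K) \<and>
        center ((adaAGC_step f L \<theta> \<gamma> ^^ N) s) = x \<and> norm (grad f x) \<le> e \<and> real N \<le> b)"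

lemma halts_within_prepend:
  assumes s': "(adaAGC_step f L \<theta> \<gamma> ^^ n) s = s'"
    and before: "\<And>j. j < n \<Longrightarrow> stages_done ((adaAGC_step f L \<theta> \<gamma> ^^ j) s) < K"
    and rest: "halts_within \<theta> \<gamma> K e s' b'" and b: "real n + b' \<le> b"
  shows "halts_within \<theta> \<gamma> K e s b"
proof -
  obtain N x where N: "stages_done ((adaAGC_step f L \<theta> \<gamma> ^^ N) s') = K"
    "\<And>m. m < N \<Longrightarrow> stages_done ((adaAGC_step f L \<theta> \<gamma> ^^ m) s') < K"
    "center ((adaAGC_step f L \<theta> \<gamma> ^^ N) s') = x" "norm (grad f x) \<le> e" "real N \<le> b'"
    using rest unfolding halts_within_def by blast
  have shift: "(adaAGC_step f L \<theta> \<gamma> ^^ (m + n)) s = (adaAGC_step f L \<theta> \<gamma> ^^ m) s'" for m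
    by (simp add: funpow_add s')
  have "stages_done ((adaAGC_step f L \<theta> \<gamma> ^^ j) s) < K" if "j < N + n" for j
  proof (cases "j < n")
    case False
    then show ?thesis
      using that N(2)[of "j - n"] shift[of "j - n"] by simp
  qed (rule before)
  then show ?thesis
    unfolding halts_within_def using N b shift[of N] by (intro exI[of _ "N + n"] exI[of _ x]) auto
qed

text \<open>
The bound is a potential: a completed stage \<open>k\<close> pays for its last cycle with \<open>T k\<close>, and a failed cycle
pays \<open>Tmax\<close> by decreasing \<open>log \<gamma> (c / ce)\<close> by 1. Failures happen only while \<open>ce < c\<close>, which keeps
\<open>ce \<le> \<gamma> c\<close> and therefore the coefficient \<open>1 + log \<gamma> (c / ce)\<close> nonnegative.
\<close>

lemma adaAGC_halts_within:
  fixes e0 c \<theta> \<gamma> Tmax :: real and T :: "nat \<Rightarrow> real" and K :: nat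
  assumes \<theta>: "0 < \<theta>" "\<theta> < 1" and c: "0 < c" and \<gamma>: "1 < \<gamma>" and e0: "0 < e0"
    and heb: "\<And>z. f z \<le> f x0 \<Longrightarrow> infdist z (minimizers f) \<le> c * (f z - min_value f) powr \<theta>"
    and small: "\<And>k ce. k < K \<Longrightarrow> c \<le> ce \<Longrightarrow> adaAGC_delta \<theta> (e0 / 2 ^ k) ce \<le> L / 6"
    and T: "\<And>k ce. k < K \<Longrightarrow> 0 < ce \<Longrightarrow> ce \<le> \<gamma> * c \<Longrightarrow>
              real (cycle_cap L (adaAGC_delta \<theta> (e0 / 2 ^ k) ce)) \<le> T k"
    and Tmax: "\<And>k. k < K \<Longrightarrow> T k \<le> Tmax" "0 \<le> Tmax"
    and start: "k \<le> K" "f z \<le> f x0" "norm (grad f z) \<le> e0 / 2 ^ k" "0 < ce" "ce \<le> \<gamma> * c"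
  shows "halts_within \<theta> \<gamma> K (e0 / 2 ^ K) (cycle_state \<theta> k z (e0 / 2 ^ k) ce 0)
           ((\<Sum>j=k..<K. T j) + (1 + log \<gamma> (c / ce)) * Tmax)"
  using start
proof (induction "(K - k) + nat \<lceil>1 + log \<gamma> (c / ce)\<rceil>" arbitrary: k z ce rule: less_induct)
  case less
  define e where "e = e0 / 2 ^ k"
  define \<delta> where "\<delta> = adaAGC_delta \<theta> e ce"
  have e: "0 < e" "e / 2 = e0 / 2 ^ Suc k"
    using e0 by (auto simp: e_def)
  have "0 < \<delta>"
    using e(1) less.prems(4) by (simp add: \<delta>_def adaAGC_delta_def)
  have nonneg: "0 \<le> 1 + log \<gamma> (c / ce)"
  proof -
    have "log \<gamma> (1 / \<gamma>) \<le> log \<gamma> (c / ce)"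
      using \<gamma> c less.prems by (subst log_le_cancel_iff) (auto simp: field_simps)
    then show ?thesis
      using \<gamma> by (simp add: log_divide)
  qed
  show ?case
  proof (cases "k = K")
    case True
    then show ?thesis
      unfolding halts_within_def using less.prems nonneg Tmax(2)
      by (intro exI[of _ 0] exI[of _ z]) simp
  next
    case False
    then have k: "k < K"
      using less.prems by simp
    show ?thesis
    proof (cases rule: cycle_outcome[where \<theta> = \<theta> and e = e and ce = ce and z = z and \<gamma> = \<gamma>
          and k = k, folded \<delta>_def])
      case (1 n)
      define x where "x = fst (cycle_iterate \<delta> z n)"
      have "f x \<le> f x0"
        using cycle_iterate_descends[OF \<open>0 < \<delta>\<close>, of z n] less.prems(2) by (simp add: x_def)
      moreover have "norm (grad f x) \<le> e0 / 2 ^ Suc k"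
        using 1(3) unfolding e(2) x_def .
      ultimately have rest: "halts_within \<theta> \<gamma> K (e0 / 2 ^ K) (cycle_state \<theta> (Suc k) x (e0 / 2 ^ Suc k) ce 0)
          ((\<Sum>j=Suc k..<K. T j) + (1 + log \<gamma> (c / ce)) * Tmax)"
        using k less.prems(4,5) by (intro less.hyps) auto
      have "real n \<le> T k"
        using 1(1) T[OF k less.prems(4,5)] unfolding \<delta>_def e_def by linarith
      then have "real n + ((\<Sum>j=Suc k..<K. T j) + (1 + log \<gamma> (c / ce)) * Tmax)
          \<le> (\<Sum>j=k..<K. T j) + (1 + log \<gamma> (c / ce)) * Tmax"
        using k by (simp add: sum.atLeast_Suc_lessThan)
      then show ?thesis
        using halts_within_prepend[OF 1(4)[folded x_def, unfolded e(2)] _ rest] 1(2) k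
        by (simp add: e_def)
    next
      case (2 n)
      have "ce < c"
      proof (rule ccontr)
        assume "\<not> ce < c"
        then have "c \<le> ce"
          by simp
        then show False
          using cycle_succeeds[OF heb \<theta> c _ e(1), of z ce n] less.prems 2(3,4) small[OF k]
          by (simp add: e_def \<delta>_def)
      qed
      have less_log: "log \<gamma> (c / (\<gamma> * ce)) = log \<gamma> (c / ce) - 1"
        using c \<gamma> less.prems(4) by (simp add: log_divide log_mult)
      have "0 < log \<gamma> (c / ce)"
        using \<open>ce < c\<close> less.prems(4) \<gamma> by simp
      then have fewer: "K - k + nat \<lceil>1 + log \<gamma> (c / (\<gamma> * ce))\<rceil> < K - k + nat \<lceil>1 + log \<gamma> (c / ce)\<rceil>"
        unfolding less_log by linarith
      have rest: "halts_within \<theta> \<gamma> K (e0 / 2 ^ K) (cycle_state \<theta> k z (e0 / 2 ^ k) (\<gamma> * ce) 0)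
          ((\<Sum>j=k..<K. T j) + (1 + log \<gamma> (c / (\<gamma> * ce))) * Tmax)"
        by (rule less.hyps[OF fewer]) (use less.prems \<gamma> \<open>ce < c\<close> in auto)
      have "real n \<le> Tmax"
        using 2(1) T[OF k less.prems(4,5)] Tmax(1)[OF k] unfolding \<delta>_def e_def by linarith
      then have "real n + ((\<Sum>j=k..<K. T j) + (1 + log \<gamma> (c / (\<gamma> * ce))) * Tmax)
          \<le> (\<Sum>j=k..<K. T j) + (1 + log \<gamma> (c / ce)) * Tmax"
        unfolding less_log by (simp add: algebra_simps)
      then show ?thesis
        using halts_within_prepend[OF 2(5)[unfolded e_def] _ rest] 2(2) k
        by (simp add: e_def)
    qed
  qed
qed

end

section \<open>Counting iterations\<close>

text \<open>
With \<open>s = L / \<delta> \<le> 6 A\<close>, the square root in the cycle length is \<open>sqrt(s + 1) \<le> sqrt(7 A)\<close> and the argument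
of the logarithm is \<open>sqrt(s (s + 1)) \<le> 8 A\<close>. The bound \<open>A \<ge> 1\<close> absorbs the rounding and the case of a
nonpositive length.
\<close>

lemma cycle_cap_le:
  assumes L_pos: "0 < L" and \<delta>: "0 < \<delta>" and A: "1 \<le> A" and le: "L / \<delta> \<le> 6 * A"
  shows "real (cycle_cap L \<delta>) \<le> 13 * sqrt A * (1 + ln A)"
proof -
  define s where "s = L / \<delta>"
  have s: "0 < s" "s \<le> 6 * A"
    using L_pos \<delta> le by (auto simp: s_def)
  have sA: "1 \<le> sqrt A" "0 \<le> ln A"
    using A by auto
  have "1 * 1 \<le> sqrt A * (1 + ln A)"
    using sA by (intro mult_mono) auto
  then have one: "1 \<le> sqrt A * (1 + ln A)"
    by simp
  have root: "sqrt ((L + \<delta>) / \<delta>) \<le> 8 / 3 * sqrt A"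
  proof -
    have "(L + \<delta>) / \<delta> = s + 1"
      using \<delta> by (simp add: s_def field_simps)
    then have "(L + \<delta>) / \<delta> \<le> (8 / 3)\<^sup>2 * A"
      using s A by (simp add: power2_eq_square)
    then have "sqrt ((L + \<delta>) / \<delta>) \<le> sqrt ((8 / 3)\<^sup>2 * A)"
      by (rule real_sqrt_le_mono)
    then show ?thesis
      by (simp add: real_sqrt_mult)
  qed
  define a where "a = sqrt (L * (L + \<delta>)) / \<delta>"
  have "0 < a"
    using L_pos \<delta> by (simp add: a_def)
  have a: "a \<le> 8 * A"
  proof (rule power2_le_imp_le)
    have "a\<^sup>2 = s * (s + 1)"
      using L_pos \<delta> by (simp add: a_def s_def power_divide field_simps power2_eq_square)
    also have "\<dots> \<le> (6 * A) * (7 * A)"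
      using s A by (intro mult_mono) auto
    also have "\<dots> \<le> (8 * A)\<^sup>2"
      using A by (simp add: power2_eq_square)
    finally show "a\<^sup>2 \<le> (8 * A)\<^sup>2" .
  qed (use A in auto)
  have "ln a \<le> ln (8 * A)"
    using a \<open>0 < a\<close> A by (subst ln_le_cancel_iff) auto
  also have "\<dots> = 3 * ln 2 + ln A"
    using A ln_realpow[of "2::real" 3] by (simp add: ln_mult)
  also have "\<dots> \<le> 25 / 12 + ln A"
    using ln2_le_25_over_36 by simp
  also have "\<dots> \<le> 25 / 12 * (1 + ln A)"
    using sA by simp
  finally have lna: "ln a \<le> 25 / 12 * (1 + ln A)" .
  have "2 * sqrt ((L + \<delta>) / \<delta>) * ln a \<le> 2 * (8 / 3 * sqrt A) * (25 / 12 * (1 + ln A))"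
  proof (cases "0 \<le> ln a")
    case True
    then show ?thesis
      using root lna L_pos \<delta> A by (intro mult_mono) auto
  next
    case False
    then have "2 * sqrt ((L + \<delta>) / \<delta>) * ln a \<le> 0"
      using L_pos \<delta> by (intro mult_nonneg_nonpos) auto
    also have "0 \<le> 2 * (8 / 3 * sqrt A) * (25 / 12 * (1 + ln A))"
      using sA by simp
    finally show ?thesis .
  qed
  also have "\<dots> = 100 / 9 * (sqrt A * (1 + ln A))"
    by simp
  finally have "real_of_int (adaAGC_cycle_length L \<delta>) \<le> 100 / 9 * (sqrt A * (1 + ln A)) + 1"
    using of_int_ceiling_le_add_one[of "2 * sqrt ((L + \<delta>) / \<delta>) * ln a"]
    unfolding adaAGC_cycle_length_def a_def[symmetric] by linarith
  then have "real (cycle_cap L \<delta>) \<le> max 1 (100 / 9 * (sqrt A * (1 + ln A)) + 1)"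
    unfolding cycle_cap_def by (auto simp: max_def)
  also have "\<dots> \<le> 13 * (sqrt A * (1 + ln A))"
    using one by simp
  finally show ?thesis
    by simp
qed

text \<open>
Only the halving after the last stage brings the tolerance down to \<open>\<epsilon>\<close>. The tolerance with which a stage
starts exceeds \<open>\<epsilon>\<close> by a factor 2 for every stage still to follow.
\<close>

lemma stage_tolerance_ge:
  fixes e0 \<epsilon> :: real
  assumes \<epsilon>: "0 < \<epsilon>" "\<epsilon> \<le> e0" and k: "k < nat \<lceil>log 2 (e0 / \<epsilon>)\<rceil>"
  shows "\<epsilon> * 2 ^ (nat \<lceil>log 2 (e0 / \<epsilon>)\<rceil> - Suc k) \<le> e0 / 2 ^ k"
proof -
  define K where "K = nat \<lceil>log 2 (e0 / \<epsilon>)\<rceil>"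
  have "real (K - 1) \<le> log 2 (e0 / \<epsilon>)"
    using k unfolding K_def by linarith
  then have "2 powr real (K - 1) \<le> e0 / \<epsilon>"
    using \<epsilon> by (simp add: le_log_iff)
  then have "2 ^ (K - 1) \<le> e0 / \<epsilon>"
    by (simp add: powr_realpow)
  moreover have "(2::real) ^ (K - Suc k) * 2 ^ k = 2 ^ (K - 1)"
    using k by (simp add: K_def power_add[symmetric])
  ultimately have "\<epsilon> * (2 ^ (K - Suc k) * 2 ^ k) \<le> e0"
    using \<epsilon> by (simp add: field_simps)
  then show ?thesis
    by (simp add: K_def field_simps)
qed

lemma final_tolerance_le:
  fixes e0 \<epsilon> :: real
  assumes \<epsilon>: "0 < \<epsilon>" "\<epsilon> \<le> e0"
  shows "e0 / 2 ^ nat \<lceil>log 2 (e0 / \<epsilon>)\<rceil> \<le> \<epsilon>"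
proof -
  define K where "K = nat \<lceil>log 2 (e0 / \<epsilon>)\<rceil>"
  have "log 2 (e0 / \<epsilon>) \<le> real K"
    unfolding K_def by linarith
  then have "e0 / \<epsilon> \<le> 2 powr real K"
    using \<epsilon> by (simp add: log_le_iff)
  then have "e0 / \<epsilon> \<le> 2 ^ K"
    by (simp add: powr_realpow)
  then show ?thesis
    using \<epsilon> by (simp add: K_def field_simps)
qed

text \<open>
The term with the factor \<open>m\<close> accounts for failed cycles, each charged like the most expensive stage. For \<open>p > 0\<close> the costs, read backwards from the last
stage, are dominated by a geometric series with ratio \<open>2 powr (- p / 2)\<close>. For \<open>p = 0\<close> every stage costs 1
and \<open>1 / ln 2 \<le> 3 / 2\<close> converts the number of stages into the natural logarithm.
\<close>

lemma stage_cost_sum_le: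
  fixes e0 \<epsilon> p m :: real
  defines "K \<equiv> nat \<lceil>log 2 (e0 / \<epsilon>)\<rceil>"
  assumes \<epsilon>: "0 < \<epsilon>" "\<epsilon> \<le> e0" and p: "0 \<le> p" and m: "1 \<le> m"
  shows "(\<Sum>k<K. 1 / (e0 / 2 ^ k) powr (p / 2)) + m * (1 / \<epsilon> powr (p / 2))
       \<le> 7 / 2 * (if p = 0 then 1 else 1 / (1 - 2 powr (- p / 2))) * m
           * max (1 / \<epsilon> powr (p / 2)) (ln (e0 / \<epsilon>))"
proof (cases "p = 0")
  case True
  define l where "l = ln (e0 / \<epsilon>)"
  have l: "0 \<le> l"
    using \<epsilon> by (simp add: l_def)
  have "l / ln 2 \<le> l / (2 / 3)"
    using l ln2_ge_two_thirds by (intro divide_left_mono) auto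
  also have "\<dots> = 3 / 2 * l"
    by simp
  finally have "l / ln 2 \<le> 3 / 2 * l" .
  moreover have "real K \<le> 1 + l / ln 2"
  proof -
    have "0 \<le> log 2 (e0 / \<epsilon>)"
      using \<epsilon> by simp
    then have "real K \<le> 1 + log 2 (e0 / \<epsilon>)"
      unfolding K_def by linarith
    then show ?thesis
      by (simp add: log_def l_def)
  qed
  ultimately have "real K \<le> 1 + 3 / 2 * l"
    by linarith
  moreover have "(1 + 3 / 2 * l) * 1 \<le> (1 + 3 / 2 * l) * m"
    using m l by (intro mult_left_mono) auto
  ultimately have "real K \<le> (1 + 3 / 2 * l) * m"
    unfolding mult_1_right by (rule order_trans)
  then have "real K + m \<le> (1 + 3 / 2 * l) * m + m"
    by (rule add_right_mono)
  also have "\<dots> = (2 + 3 / 2 * l) * m"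
    by (simp add: algebra_simps)
  also have "\<dots> \<le> (7 / 2 * max 1 l) * m"
    using m by (intro mult_right_mono) (auto simp: max_def)
  finally show ?thesis
    using True \<epsilon> by (simp add: l_def[symmetric] mult.commute mult.left_commute)
next
  case False
  define r where "r = 2 powr (- p / 2)"
  have r: "0 < r" "r < 1"
    using p False by (auto simp: r_def powr_less_one)
  define E where "E = 1 / \<epsilon> powr (p / 2)"
  have E: "0 < E"
    using \<epsilon> by (simp add: E_def)
  have "(\<Sum>k<K. 1 / (e0 / 2 ^ k) powr (p / 2)) \<le> (\<Sum>k<K. E * r ^ (K - Suc k))"
  proof (rule sum_mono)
    fix k assume "k \<in> {..<K}"
    then have "(\<epsilon> * 2 ^ (K - Suc k)) powr (p / 2) \<le> (e0 / 2 ^ k) powr (p / 2)"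
      using stage_tolerance_ge[OF \<epsilon>, of k] \<epsilon> p unfolding K_def by (intro powr_mono2) auto
    then have "1 / (e0 / 2 ^ k) powr (p / 2) \<le> 1 / (\<epsilon> * 2 ^ (K - Suc k)) powr (p / 2)"
      using \<epsilon> by (intro divide_left_mono) auto
    also have "\<dots> = E * r ^ (K - Suc k)"
      using \<epsilon> by (simp add: E_def r_def powr_mult powr_realpow[symmetric] powr_powr powr_minus field_simps)
    finally show "1 / (e0 / 2 ^ k) powr (p / 2) \<le> E * r ^ (K - Suc k)" .
  qed
  also have "\<dots> = E * (\<Sum>i<K. r ^ i)"
    by (simp add: sum_distrib_left[symmetric] sum.nat_diff_reindex)
  also have "\<dots> \<le> E * (1 / (1 - r))"
    using E r by (intro mult_left_mono) (auto simp: sum_gp_strict divide_right_mono)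
  finally have 1: "(\<Sum>k<K. 1 / (e0 / 2 ^ k) powr (p / 2)) \<le> E * (1 / (1 - r))" .
  define H where "H = 1 / (1 - r)"
  have H: "1 \<le> H"
    using r by (simp add: H_def)
  have "E * H \<le> H * m * E"
    using mult_right_mono[OF mult_left_mono[OF m, of H], of E] H E by (simp add: mult.commute)
  moreover have "m * E \<le> H * m * E"
    using mult_right_mono[OF mult_right_mono[OF H, of m], of E] m E by simp
  ultimately have "E * H + m * E \<le> 2 * (H * m * E)"
    by linarith
  also have "\<dots> \<le> 7 / 2 * (H * m * max E (ln (e0 / \<epsilon>)))"
    using H m E by (intro mult_mono mult_left_mono mult_nonneg_nonneg) auto
  finally show ?thesis
    using 1 False by (simp add: E_def r_def H_def mult.assoc)
qed

theorem theorem7: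
  fixes f :: "real ^ 'n \<Rightarrow> real" and x0 :: "real ^ 'n"
    and L \<xi>0 \<theta> c c0 \<gamma> \<epsilon>0 \<epsilon> p :: real and K :: nat
  assumes "convex_on UNIV f"
    and "L > 0" and "smooth_fun L f"
    and "minimizers f \<noteq> {}"
    and "f x0 - min_value f \<le> \<xi>0"
    and "0 < \<theta>" and "\<theta> \<le> 1 / 2" and "c > 0"
    and "HEB_on (sublevel f \<xi>0) f \<theta> c"
    and "0 < c0" and "c0 \<le> c" and "\<gamma> > 1"
    and "\<epsilon>0 = norm (grad f x0)"
    and "0 < \<epsilon>" and "\<epsilon> \<le> \<epsilon>0"
    and "K = nat \<lceil>log 2 (\<epsilon>0 / \<epsilon>)\<rceil>"
    and "p = (1 - 2 * \<theta>) / (1 - \<theta>)"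
  shows "\<exists>N xK. adaAGC_halts f L \<theta> \<gamma> x0 c0 K N xK \<and>
           norm (grad f xK) \<le> \<epsilon> \<and>
           real N \<le> hidden_const \<theta> \<gamma> * suppressed_log \<theta> c c0 L \<gamma> \<epsilon> *
             (sqrt L * c powr (1 / (2 * (1 - \<theta>))) *
              max (1 / \<epsilon> powr (p / 2)) (ln (\<epsilon>0 / \<epsilon>)))"
proof -
  interpret convex_smooth_problem f L
    using assms(1-4) by unfold_locales
  have \<theta>: "0 < \<theta>" "\<theta> < 1"
    using assms(6,7) by auto
  have c: "0 < c" and c0: "0 < c0" "c0 \<le> c" and \<gamma>: "1 < \<gamma>" and \<epsilon>: "0 < \<epsilon>" "\<epsilon> \<le> \<epsilon>0"
    using assms by auto
  have e0: "0 < \<epsilon>0"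
    using \<epsilon> by simp
  have p: "0 \<le> p" "p = 0 \<longleftrightarrow> \<theta> = 1 / 2"
    using assms(7) \<theta> unfolding assms(17) by auto
  have heb: "infdist z (minimizers f) \<le> c * (f z - min_value f) powr \<theta>" if "f z \<le> f x0" for z
    using assms(5,9) that unfolding HEB_on_def sublevel_def by auto
  have start: "\<epsilon>0 powr p \<le> L * c powr (1 / (1 - \<theta>))"
    using HEB_grad_powr_le[OF heb \<theta> c, of x0] e0 unfolding assms(13,17) by simp
  \<comment> \<open>the worst case of the run: tolerances at least \<open>\<epsilon>\<close>, estimates of \<open>c\<close> at most \<open>\<gamma> * c\<close>\<close>
  define Q where "Q = L * (\<gamma> * c) powr (1 / (1 - \<theta>))"
  have Q: "0 < Q"
    using L_pos c \<gamma> by (simp add: Q_def)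
  define \<Lambda> where "\<Lambda> = 1 + ln (Q / \<epsilon> powr p)"
  define e where "e k = \<epsilon>0 / 2 ^ k" for k :: nat
  define T where "T k = 13 * sqrt Q * \<Lambda> * (1 / e k powr (p / 2))" for k
  define Tmax where "Tmax = 13 * sqrt Q * \<Lambda> * (1 / \<epsilon> powr (p / 2))"
  have e_le: "e k powr p \<le> L * ce powr (1 / (1 - \<theta>))" if "c \<le> ce" for k ce
  proof -
    have "e k powr p \<le> \<epsilon>0 powr p"
      using e0 p by (intro powr_mono2) (auto simp: e_def field_simps)
    also note start
    also have "L * c powr (1 / (1 - \<theta>)) \<le> L * ce powr (1 / (1 - \<theta>))"
      using L_pos c that \<theta> by (intro mult_left_mono powr_mono2) auto
    finally show ?thesis .
  qed
  have e_ge: "\<epsilon> \<le> e k" if "k < K" for k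
  proof -
    have "\<epsilon> * 1 \<le> \<epsilon> * 2 ^ (K - Suc k)"
      using \<epsilon> by (intro mult_left_mono) auto
    also have "\<dots> \<le> e k"
      using stage_tolerance_ge[OF \<epsilon>, of k] that unfolding assms(16) e_def by simp
    finally show ?thesis by simp
  qed
  have A_ge: "1 \<le> Q / e k powr p" for k
    using e_le[of "\<gamma> * c" k] \<gamma> c e0 by (simp add: Q_def e_def)
  have small: "adaAGC_delta \<theta> (\<epsilon>0 / 2 ^ k) ce \<le> L / 6" if "c \<le> ce" for k ce
  proof -
    have "0 < ce powr (1 / (1 - \<theta>))"
      using that c by simp
    then show ?thesis
      using e_le[OF that, of k] unfolding adaAGC_delta_def assms(17)[symmetric] e_def[symmetric]
      by (simp add: field_simps)
  qed
  have A_le: "Q / e k powr p \<le> Q / \<epsilon> powr p" if "\<epsilon> \<le> e k" for k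
    using that \<epsilon> p Q by (intro divide_left_mono powr_mono2) auto
  have \<Lambda>: "1 + ln (Q / e k powr p) \<le> \<Lambda>" if "k < K" for k
  proof -
    have "0 < Q / e k powr p"
      using A_ge[of k] by linarith
    then show ?thesis
      unfolding \<Lambda>_def using A_le[OF e_ge[OF that]] by (simp add: ln_mono)
  qed
  have \<Lambda>_pos: "1 \<le> \<Lambda>"
    unfolding \<Lambda>_def using A_ge[of 0] A_le[of 0] \<epsilon>(2) by (simp add: e_def)
  have sqrt_powr: "sqrt (x powr a) = x powr (a / 2)" for x a :: real
    by (simp add: powr_half_sqrt[symmetric] powr_powr)
  have T: "real (cycle_cap L (adaAGC_delta \<theta> (\<epsilon>0 / 2 ^ k) ce)) \<le> T k"
    if "k < K" "0 < ce" "ce \<le> \<gamma> * c" for k ce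
  proof -
    define \<delta> where "\<delta> = adaAGC_delta \<theta> (e k) ce"
    have ek: "0 < e k"
      using e0 by (simp add: e_def)
    have \<delta>: "0 < \<delta>"
      using ek that(2) by (simp add: \<delta>_def adaAGC_delta_def)
    have "L / \<delta> = 6 * (L * ce powr (1 / (1 - \<theta>)) / e k powr p)"
      by (simp add: \<delta>_def adaAGC_delta_def assms(17))
    also have "\<dots> \<le> 6 * (Q / e k powr p)"
      unfolding Q_def using that \<theta> L_pos
      by (intro mult_left_mono divide_right_mono powr_mono2) auto
    finally have "real (cycle_cap L \<delta>) \<le> 13 * sqrt (Q / e k powr p) * (1 + ln (Q / e k powr p))"
      by (rule cycle_cap_le[OF L_pos \<delta> A_ge])
    also have "\<dots> \<le> 13 * sqrt (Q / e k powr p) * \<Lambda>"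
      using Q by (intro mult_left_mono \<Lambda> that) auto
    also have "\<dots> = T k"
      by (simp add: T_def real_sqrt_divide sqrt_powr)
    finally show ?thesis
      by (simp add: \<delta>_def e_def)
  qed
  have Tmax: "T k \<le> Tmax" if "k < K" for k
    unfolding T_def Tmax_def using e_ge[OF that] \<epsilon> p Q \<Lambda>_pos
    by (intro mult_left_mono divide_left_mono powr_mono2) auto
  have Tmax0: "0 \<le> Tmax"
    using Q \<Lambda>_pos by (simp add: Tmax_def)
  have "halts_within \<theta> \<gamma> K (\<epsilon>0 / 2 ^ K) (cycle_state \<theta> 0 x0 (\<epsilon>0 / 2 ^ 0) c0 0)
      ((\<Sum>j=0..<K. T j) + (1 + log \<gamma> (c / c0)) * Tmax)"
  proof (rule adaAGC_halts_within[OF \<theta> c \<gamma> e0 heb small T Tmax Tmax0])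
    show "c0 \<le> \<gamma> * c"
    proof -
      have "1 * c \<le> \<gamma> * c"
        using \<gamma> c by (intro mult_right_mono) auto
      then show ?thesis
        using c0 by linarith
    qed
  qed (use c0 assms(13) in auto)
  then obtain N x where N: "adaAGC_halts f L \<theta> \<gamma> x0 c0 K N x" "norm (grad f x) \<le> \<epsilon>0 / 2 ^ K"
    "real N \<le> (\<Sum>j=0..<K. T j) + (1 + log \<gamma> (c / c0)) * Tmax"
    unfolding halts_within_def adaAGC_halts_def adaAGC_def adaAGC_init_eq[of x0 c0 \<theta>] assms(13)
    by auto
  have "norm (grad f x) \<le> \<epsilon>"
    using N(2) final_tolerance_le[OF \<epsilon>] unfolding assms(16) by linarith
  moreover have "real N \<le> hidden_const \<theta> \<gamma> * suppressed_log \<theta> c c0 L \<gamma> \<epsilon> *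
      (sqrt L * c powr (1 / (2 * (1 - \<theta>))) * max (1 / \<epsilon> powr (p / 2)) (ln (\<epsilon>0 / \<epsilon>)))"
  proof -
    define m where "m = 1 + log \<gamma> (c / c0)"
    define g where "g = (if p = 0 then 1 else 1 / (1 - 2 powr (- p / 2)))"
    define h where "h = max (1 / \<epsilon> powr (p / 2)) (ln (\<epsilon>0 / \<epsilon>))"
    have m: "1 \<le> m"
      using c0 \<gamma> by (simp add: m_def)
    have g: "0 \<le> g"
      using p(1) powr_mono[of "- p / 2" 0 "2::real"] by (auto simp: g_def)
    have h: "0 \<le> h"
      by (auto simp: h_def le_max_iff_disj)
    have Q_split: "sqrt Q = sqrt L * \<gamma> powr (1 / (2 * (1 - \<theta>))) * c powr (1 / (2 * (1 - \<theta>)))"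
      using \<gamma> c by (simp add: Q_def real_sqrt_mult powr_mult sqrt_powr mult.commute)
    have "real N \<le> 13 * sqrt Q * \<Lambda> * ((\<Sum>k<K. 1 / e k powr (p / 2)) + m * (1 / \<epsilon> powr (p / 2)))"
      using N(3) by (simp add: T_def Tmax_def m_def sum_distrib_left atLeast0LessThan algebra_simps)
    also have "\<dots> \<le> 13 * sqrt Q * \<Lambda> * (7 / 2 * g * m * h)"
      using stage_cost_sum_le[OF \<epsilon> p(1) m] Q \<Lambda>_pos
      unfolding assms(16) e_def g_def h_def by (intro mult_left_mono) auto
    \<comment> \<open>the powers of \<open>\<gamma>\<close> and \<open>c\<close> contained in \<open>sqrt Q\<close> go to the hidden constant and to the main term\<close>
    also have "\<dots> = 91 / 2 * (sqrt Q * \<Lambda> * g * m * h)"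
      by simp
    also have "\<dots> \<le> 100 * (sqrt Q * \<Lambda> * g * m * h)"
      using Q \<Lambda>_pos g m h by (intro mult_right_mono mult_nonneg_nonneg) auto
    also have "\<dots> = hidden_const \<theta> \<gamma> * suppressed_log \<theta> c c0 L \<gamma> \<epsilon> *
        (sqrt L * c powr (1 / (2 * (1 - \<theta>))) * h)"
    proof -
      have "hidden_const \<theta> \<gamma> = 100 * \<gamma> powr (1 / (2 * (1 - \<theta>))) * g"
        using p(2) unfolding hidden_const_def g_def assms(17)[symmetric] by simp
      moreover have "suppressed_log \<theta> c c0 L \<gamma> \<epsilon> = m * \<Lambda>"
        unfolding suppressed_log_def m_def \<Lambda>_def Q_def assms(17)[symmetric] by simp
      ultimately show ?thesis
        unfolding Q_split by (simp add: mult.commute mult.left_commute)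
    qed
    finally show ?thesis
      by (simp add: h_def)
  qed
  ultimately show ?thesis
    using N(1) by blast
qed

end
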